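(* Let $K$ be a non-degenerate diagonal real $2\times 2$ matrix and consider Problem 1: $$\int_0^\infty \langle x(t),x(t)\rangle\,dt\to\inf,\qquad \dot x=y,\quad \dot y=Kx+u,\quad \|u(t)\|\le 1,\qquad x(0)=x^0,\ y(0)=y^0,$$ with $x,y,u\in\mathbb{R}^2$. There exists a family of optimal solutions of Problem 1 (for suitable initial data $(x^0,y^0)$) that are spiral-like, i.e. of the form, for $0\le t<T$, $$x^*(t)=k_x\,(T-t)^2e^{i\alpha\log|T-t|}\,\bigl(1+g_x(T-t)\bigr),$$ $$y^*(t)=k_y\,(T-t)e^{i\alpha\log|T-t|}\,\bigl(1+g_y(T-t)\bigr),$$ $$u^*(t)=k_u\,e^{i\alpha\log|T-t|}\,\bigl(1+g_u(T-t)\bigr),$$ and of all possible rotations and reflections of this form. These solutions hit the origin $(x,y)=(0,0)$ in a finite time $T$ (the hitting time), making a countably infinite number of rotations. Here $\alpha=\pm\sqrt5$, $k_x,k_y,k_u\in\mathbb{C}$, $i^2=-1$, and there is $\sigma>0$ such that $$g_x(T-t),\ g_y(T-t),\ g_u(T-t)=o\bigl((T-t)^\sigma\bigr)\quad\text{as } t\to T-0.$$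
   Context: $\langle\cdot,\cdot\rangle$ and $\|\cdot\|$ are the standard scalar product and Euclidean norm on $\mathbb{R}^2$. Vectors of $\mathbb{R}^2$ are written in complex notation: $Re^{i\varphi}=(R\cos\varphi,R\sin\varphi)$, so $x^*,y^*,u^*$ are identified with complex-valued functions and products such as $k_x(T-t)^2e^{i\alpha\log|T-t|}(1+g_x)$ are products of complex numbers. An optimal solution is an admissible triple $(x(t),y(t),u(t))$ (with $u$ a measurable control, $\|u(t)\|\le1$, and $(x,y)$ the corresponding absolutely continuous trajectory with the given initial data) minimizing the functional among all admissible triples with the same initial data. "All possible rotations and reflections" of the displayed form means the action of orthogonal transformations $\zeta$ of $\mathbb{R}^2\cong\mathbb{C}$ simultaneously on the leading spirals $k_x(T-t)^2e^{i\alpha\log|T-t|}$, $k_y(T-t)e^{i\alpha\log|T-t|}$, $k_ue^{i\alpha\log|T-t|}$: a rotation multiplies $k_x,k_y,k_u$ by a common unimodular constant; a reflection amounts (up to rotation) to complex conjugation, which replaces $\alpha$ by $-\alpha$ and the constants by their conjugates. *)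

theory Defs
  imports "HOL-Analysis.Analysis" "HOL-Library.Landau_Symbols"
begin

text \<open>
  The members of a division are finitely many compact intervals \<open>{Inf I..Sup I}\<close> with pairwise
  disjoint interiors, so this is the usual epsilon-delta notion of absolute continuity.
\<close>

definition abs_cont_on :: "real set \<Rightarrow> (real \<Rightarrow> 'a::real_normed_vector) \<Rightarrow> bool" where
  "abs_cont_on S f \<longleftrightarrow>
    (\<forall>\<epsilon>>0. \<exists>\<delta>>0. \<forall>D. D division_of \<Union>D \<and> \<Union>D \<subseteq> S \<and> (\<Sum>I\<in>D. Sup I - Inf I) < \<delta> \<longrightarrow>
      (\<Sum>I\<in>D. norm (f (Sup I) - f (Inf I))) < \<epsilon>)"

text \<open>
  Controls are Lebesgue measurable; trajectories are absolutely continuous on compact time intervals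
  and satisfy the differential equations almost everywhere. Values at negative times are irrelevant.
\<close>

definition admissible ::
  "real^2^2 \<Rightarrow> real^2 \<Rightarrow> real^2 \<Rightarrow> (real \<Rightarrow> real^2) \<Rightarrow> (real \<Rightarrow> real^2) \<Rightarrow> (real \<Rightarrow> real^2) \<Rightarrow> bool" where
  "admissible K x0 y0 x y u \<longleftrightarrow>
    u \<in> borel_measurable (lebesgue_on {0..}) \<and> (\<forall>t\<ge>0. norm (u t) \<le> 1) \<and>
    (\<forall>b\<ge>0. abs_cont_on {0..b} x \<and> abs_cont_on {0..b} y) \<and>
    (AE t in lebesgue_on {0..}. (x has_vector_derivative y t) (at t)) \<and>
    (AE t in lebesgue_on {0..}. (y has_vector_derivative (K *v x t + u t)) (at t)) \<and>
    x 0 = x0 \<and> y 0 = y0"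

text \<open>The integrand is nonnegative; the value of the functional may be infinite.\<close>

definition cost :: "(real \<Rightarrow> real^2) \<Rightarrow> ennreal" where
  "cost x = (\<integral>\<^sup>+t\<in>{0..}. ennreal (x t \<bullet> x t) \<partial>lebesgue)"

definition optimal ::
  "real^2^2 \<Rightarrow> real^2 \<Rightarrow> real^2 \<Rightarrow> (real \<Rightarrow> real^2) \<Rightarrow> (real \<Rightarrow> real^2) \<Rightarrow> (real \<Rightarrow> real^2) \<Rightarrow> bool" where
  "optimal K x0 y0 x y u \<longleftrightarrow>
    admissible K x0 y0 x y u \<and>
    (\<forall>x' y' u'. admissible K x0 y0 x' y' u' \<longrightarrow> cost x \<le> cost x')"

definition cplx :: "real^2 \<Rightarrow> complex" where
  "cplx v = Complex (v $ 1) (v $ 2)"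

text \<open>
  \<open>spiral_form \<zeta> k p \<alpha> \<sigma> T f\<close>: the curve \<open>f\<close> is
  \<open>\<zeta> (k (T - t)\<^sup>p exp(\<i> \<alpha> ln\<bar>T - t\<bar>)) (1 + g (T - t))\<close> on \<open>[0, T)\<close>, with
  \<open>g (T - t) = o((T - t)\<^sup>\<sigma>)\<close> as \<open>t\<close> tends to \<open>T\<close> from the left. Note that \<open>\<zeta>\<close> acts on the leading
  spiral only.
\<close>

definition spiral_form ::
  "(complex \<Rightarrow> complex) \<Rightarrow> complex \<Rightarrow> nat \<Rightarrow> real \<Rightarrow> real \<Rightarrow> real \<Rightarrow> (real \<Rightarrow> complex) \<Rightarrow> bool" where
  "spiral_form \<zeta> k p \<alpha> \<sigma> T f \<longleftrightarrow>
    (\<exists>g :: real \<Rightarrow> complex.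
      (\<forall>t. 0 \<le> t \<and> t < T \<longrightarrow>
        f t = \<zeta> (k * of_real ((T - t) ^ p) * exp (\<i> * of_real (\<alpha> * ln \<bar>T - t\<bar>))) * (1 + g (T - t))) \<and>
      (\<lambda>t. g (T - t)) \<in> o[at_left T](\<lambda>t. of_real ((T - t) powr \<sigma>)))"

text \<open>
  Along a continuous branch \<open>\<theta>\<close> of the argument, the number of complete turns made during \<open>[0, t]\<close>
  is finite for each \<open>t < T\<close> and grows without bound as \<open>t\<close> tends to \<open>T\<close>: the curve makes countably
  infinitely many rotations about the origin before the time \<open>T\<close>.
\<close>

definition infinitely_many_rotations :: "real \<Rightarrow> (real \<Rightarrow> complex) \<Rightarrow> bool" where
  "infinitely_many_rotations T f \<longleftrightarrow>
    (\<exists>\<theta> :: real \<Rightarrow> real.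
      continuous_on {0..<T} \<theta> \<and>
      (\<forall>t\<in>{0..<T}. f t \<noteq> 0 \<and> f t = rcis (norm (f t)) (\<theta> t)) \<and>
      filterlim (\<lambda>t. \<bar>\<theta> t\<bar>) at_top (at_left T))"

end

(* The problem is convex, so an admissible triple is optimal as soon as it comes with a costate psi
satisfying psi'' = K psi - x, u = psi / |psi| and psi = psi' = 0 at the hitting time T.
In reversed time s = T - t this is the singular system X'' = K X + Psi / |Psi|, Psi'' = K Psi - X
with zero data at s = 0. For K = 0 it has the exact solution Psi = s^(4 + i alpha) / 126,
X = - Psi'', because (1 + i alpha)(2 + i alpha)(3 + i alpha)(4 + i alpha) = -126 when alpha^2 = 5.
For general K the corrections X - X0 = O(s^4) and Psi - Psi0 = O(s^6) are found by the contraction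
principle: the direction Psi / |Psi| is Lipschitz with constant about 126 / s^4, and two double
integrations of functions of these orders gain a factor 1 / (3 * 4 * 5 * 6) = 1 / 360.
Since K need not commute with a rotation or reflection, the leading spiral is transformed first and
the correction is constructed afterwards. *)

theory Submission
  imports Defs
begin

section \<open>Absolutely continuous functions\<close>

text \<open>Shortening the interval makes the \<open>K\<close> terms small, but not the direction
  term: an error of order s^6 in Psi turns the direction by order s^2, and four integrations return
  exactly order s^6. The contraction therefore rests on the numerical fact 126 / 360 < 1. The orders
  matter: for errors of order s^4, the order of Psi0 itself, the factor would be 126 / 24 > 1, so
  the two extra orders supplied by the \<open>K\<close> terms are essential. The exponent is forced
  as well. With z = i alpha the product of the four factors is z^4 + 10 z^3 + 35 z^2 + 50 z + 24,
  which is real only for alpha = 0 or alpha^2 = 5; for alpha = 0 it equals 24 and has the wrong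
  sign. On the optimality side the obstacle is that competitors are merely absolutely continuous,
  with derivatives almost everywhere. The first variation is therefore integrated by a monotonicity
  theorem for such functions. The hitting time is not prescribed: any small T may be cut out of the
  reversed solution, and the initial data are read off at s = T.\<close>

lemma abs_cont_onE:
  assumes "abs_cont_on S f" "e > 0"
  obtains d where "d > 0"
    "\<And>D. D division_of \<Union>D \<Longrightarrow> \<Union>D \<subseteq> S \<Longrightarrow> (\<Sum>I\<in>D. Sup I - Inf I) < d \<Longrightarrow>
      (\<Sum>I\<in>D. norm (f (Sup I) - f (Inf I))) < e"
proof -
  obtain d where "d > 0" and "\<forall>D. D division_of \<Union>D \<and> \<Union>D \<subseteq> S \<and> (\<Sum>I\<in>D. Sup I - Inf I) < d \<longrightarrow>
      (\<Sum>I\<in>D. norm (f (Sup I) - f (Inf I))) < e"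
    using assms unfolding abs_cont_on_def by blast
  then show ?thesis by (intro that) auto
qed

text \<open>This replaces the fundamental theorem of calculus for absolutely continuous functions.
  In a fine tagged division, intervals tagged outside \<open>N\<close> have increments controlled by
  the derivative, while those tagged in \<open>N\<close> lie in an open set of small measure, where
  absolute continuity applies.\<close>

lemma abs_cont_on_nonincreasing:
  fixes f :: "real \<Rightarrow> real"
  assumes ac: "abs_cont_on {a..b} f" and ab: "a \<le> b" and neg: "negligible N"
    and der: "\<And>t. t \<in> {a..b} - N \<Longrightarrow> \<exists>d\<le>0. (f has_real_derivative d) (at t)"
  shows "f b \<le> f a"
proof (rule field_le_epsilon)
  fix e :: real assume "e > 0"
  \<comment> \<open>Half of \<open>e\<close> pays for slopes of at most \<open>c\<close>, the other
    half for the exceptional set; the \<open>+ 1\<close> covers \<open>a = b\<close>.\<close>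
  define c where "c = e / (2 * (b - a + 1))"
  have c: "c > 0" "c * (b - a) \<le> e / 2"
    using \<open>e > 0\<close> ab by (auto simp: c_def field_simps)
  obtain \<delta> where \<delta>: "\<delta> > 0" and small:
    "\<And>D. D division_of \<Union>D \<Longrightarrow> \<Union>D \<subseteq> {a..b} \<Longrightarrow> (\<Sum>I\<in>D. Sup I - Inf I) < \<delta> \<Longrightarrow>
      (\<Sum>I\<in>D. norm (f (Sup I) - f (Inf I))) < e / 2"
    using abs_cont_onE[OF ac half_gt_zero[OF \<open>e > 0\<close>]] by blast
  have N0: "N \<in> null_sets lebesgue" using neg negligible_iff_null_sets by blast
  then obtain U where U: "open U" "N \<subseteq> U" "U - N \<in> lmeasurable" "emeasure lebesgue (U - N) < ennreal \<delta>"
    using sets_lebesgue_outer_open[of N \<delta>] \<delta> by blast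
  have Um: "U \<in> lmeasurable" "measure lebesgue U < \<delta>"
  proof -
    have Ueq: "U = (U - N) \<union> N" using U by auto
    then show "U \<in> lmeasurable"
      by (metis N0 U(3) fmeasurable.Un fmeasurableI_null_sets)
    have "measure lebesgue U = measure lebesgue (U - N)"
      using measure_Un_null_set[of "U - N" lebesgue N] U(3) N0 Ueq by auto
    also have "ennreal \<dots> < ennreal \<delta>"
      using U(3,4) by (simp add: emeasure_eq_measure2)
    then have "measure lebesgue (U - N) < \<delta>"
      by (simp add: ennreal_less_iff)
    finally show "measure lebesgue U < \<delta>" .
  qed
  \<comment> \<open>Straddle estimate: the increment is compared over an interval that contains the
    tag \<open>x\<close>, since both one-sided errors are then measured by lengths that add up to
    \<open>v - u\<close>.\<close>
  have "\<exists>r>0. \<forall>u v. u \<in> {a..b} \<and> v \<in> {a..b} \<and> u \<le> x \<and> x \<le> v \<and> dist x u < r \<and> dist x v < r \<longrightarrow>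
      f v - f u \<le> c * (v - u)" if x: "x \<in> {a..b} - N" for x
  proof -
    obtain d where d: "d \<le> 0" "(f has_derivative (\<lambda>h. d * h)) (at x)"
      using der[OF x] by (auto simp: has_field_derivative_def)
    then obtain r where r: "r > 0" "\<And>y. norm (y - x) < r \<Longrightarrow> norm (f y - f x - d * (y - x)) \<le> c * norm (y - x)"
      using c unfolding has_derivative_at_alt by blast
    have "f v - f u \<le> c * (v - u)" if "u \<le> x" "x \<le> v" "dist x u < r" "dist x v < r" for u v
    proof -
      have "f v - f x - d * (v - x) \<le> c * (v - x)"
        using r(2)[of v] that by (auto simp: dist_real_def)
      moreover have "- (f u - f x - d * (u - x)) \<le> c * (x - u)"
        using r(2)[of u] that by (auto simp: dist_real_def)
      moreover have "d * (v - u) \<le> 0" using d that by (simp add: mult_nonpos_nonneg)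
      ultimately show ?thesis by (simp add: algebra_simps)
    qed
    then show ?thesis using r(1) by blast
  qed
  then obtain r where r: "\<And>x. x \<in> {a..b} - N \<Longrightarrow> r x > 0"
    "\<And>x u v. x \<in> {a..b} - N \<Longrightarrow> u \<in> {a..b} \<Longrightarrow> v \<in> {a..b} \<Longrightarrow> u \<le> x \<Longrightarrow> x \<le> v \<Longrightarrow> dist x u < r x
      \<Longrightarrow> dist x v < r x \<Longrightarrow> f v - f u \<le> c * (v - u)"
    by metis
  \<comment> \<open>On \<open>N\<close> the gauge is the whole open set \<open>U\<close>, so all
    intervals tagged there have total length below \<open>\<delta>\<close>. Off
    \<open>{a..b}\<close> the unit ball is a dummy.\<close>
  define \<gamma> where "\<gamma> = (\<lambda>x. if x \<in> N then U else if x \<in> {a..b} then ball x (r x) else ball x 1)"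
  have "gauge \<gamma>" unfolding gauge_def \<gamma>_def using U r(1) by auto
  then obtain p where p: "p tagged_division_of {a..b}" "\<gamma> fine p"
    using fine_division_exists_real by blast
  have pD: "x \<in> K" "K \<subseteq> {a..b}" "\<exists>u v. K = {u..v} \<and> u \<le> v" "K \<subseteq> \<gamma> x" if "(x, K) \<in> p" for x K
  proof -
    show "x \<in> K" "K \<subseteq> {a..b}" "K \<subseteq> \<gamma> x"
      using tagged_division_ofD(2,3)[OF p(1) that] fineD[OF p(2) that] by blast+
    then show "\<exists>u v. K = {u..v} \<and> u \<le> v"
      using tagged_division_ofD(4)[OF p(1) that] by (metis atLeastAtMost_iff box_real(2) order_trans)
  qed
  have fin: "finite p" using tagged_division_ofD(1)[OF p(1)] .
  define q where "q = {(x, K) \<in> p. x \<in> N}"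
  have q: "q \<subseteq> p" by (auto simp: q_def)
  then have finq: "finite q" using fin finite_subset by blast
  have qpart: "q tagged_partial_division_of {a..b}"
    using tagged_partial_division_subset[OF _ q] p(1) by (simp add: tagged_division_of_def)
  then have qdiv: "snd ` q division_of \<Union>(snd ` q)"
    by (rule partial_division_of_tagged_division)
  have degen: "Sup K = Inf K" if "(x, K) \<in> p" "interior K = {}" for x K
    using pD(3)[OF that(1)] that(2) by (auto simp: interior_atLeastAtMost_real)
  \<comment> \<open>Absolute continuity speaks of sets of intervals, the division of tagged
    intervals. Two tags can share an interval only if it is degenerate, and then its term is some
    \<open>h s s = 0\<close>.\<close>
  have snd_sum: "(\<Sum>I\<in>snd ` q. h (Sup I) (Inf I)) = (\<Sum>(x, K)\<in>q. h (Sup K) (Inf K))"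
    if "\<And>s. h s s = 0" for h :: "real \<Rightarrow> real \<Rightarrow> real"
  proof -
    have "(\<Sum>I\<in>snd ` q. h (Sup I) (Inf I)) = sum ((\<lambda>I. h (Sup I) (Inf I)) \<circ> snd) q"
    proof (rule sum.reindex_nontrivial[OF finq])
      fix y z assume yz: "y \<in> q" "z \<in> q" "y \<noteq> z" "snd y = snd z"
      obtain x1 x2 K where K: "y = (x1, K)" "z = (x2, K)" using yz by (metis prod.collapse)
      have "interior K \<inter> interior K = {}"
        using tagged_division_ofD(5)[OF p(1), of x1 K x2 K] yz K q by auto
      then have "Sup K = Inf K" using degen[of x1 K] K yz q by auto
      then show "h (Sup (snd y)) (Inf (snd y)) = 0" using that K by simp
    qed
    then show ?thesis by (simp add: case_prod_unfold)
  qed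
  have "(\<Sum>I\<in>snd ` q. Sup I - Inf I) = (\<Sum>I\<in>snd ` q. measure lebesgue I)"
  proof (rule sum.cong[OF refl])
    fix I assume "I \<in> snd ` q"
    then obtain x where "(x, I) \<in> p" using q by auto
    from pD(3)[OF this] show "Sup I - Inf I = measure lebesgue I" by auto
  qed
  also have "\<dots> = measure lebesgue (\<Union>(snd ` q))"
    using content_division[OF qdiv] by simp
  also have "\<dots> \<le> measure lebesgue U"
  proof (rule measure_mono_fmeasurable[OF _ _ Um(1)])
    show "\<Union> (snd ` q) \<subseteq> U"
    proof clarsimp
      fix y x I assume "(x, I) \<in> q" "y \<in> I"
      then show "y \<in> U" using pD(4)[of x I] by (auto simp: q_def \<gamma>_def)
    qed
    show "\<Union> (snd ` q) \<in> sets lebesgue" using lmeasurable_division[OF qdiv] by blast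
  qed
  finally have "(\<Sum>I\<in>snd ` q. Sup I - Inf I) < \<delta>" using Um by simp
  moreover have "\<Union>(snd ` q) \<subseteq> {a..b}"
  proof clarify
    fix y x I assume "(x, I) \<in> q" "y \<in> snd (x, I)"
    then have "(x, I) \<in> p" "y \<in> I" using q by auto
    then show "y \<in> {a..b}" using pD(2) by blast
  qed
  ultimately have "(\<Sum>I\<in>snd ` q. norm (f (Sup I) - f (Inf I))) < e / 2"
    using small[OF qdiv] by blast
  then have 1: "(\<Sum>(x, K)\<in>q. norm (f (Sup K) - f (Inf K))) < e / 2"
    using snd_sum[of "\<lambda>s i. norm (f s - f i)"] by simp
  have "f b - f a = (\<Sum>(x, K)\<in>p. f (Sup K) - f (Inf K))"
    by (rule additive_tagged_division_1[OF ab p(1), symmetric])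
  also have "\<dots> = (\<Sum>(x, K)\<in>p - q. f (Sup K) - f (Inf K)) + (\<Sum>(x, K)\<in>q. f (Sup K) - f (Inf K))"
    by (rule sum.subset_diff[OF q fin])
  also have "(\<Sum>(x, K)\<in>q. f (Sup K) - f (Inf K)) \<le> (\<Sum>(x, K)\<in>q. norm (f (Sup K) - f (Inf K)))"
    by (rule sum_mono) auto
  also have "\<dots> \<le> e / 2" using 1 by simp
  also have "(\<Sum>(x, K)\<in>p - q. f (Sup K) - f (Inf K)) \<le> (\<Sum>(x, K)\<in>p - q. c * (Sup K - Inf K))"
  proof (rule sum_mono, clarify)
    fix x K assume xK: "(x, K) \<in> p" "(x, K) \<notin> q"
    obtain u v where uv: "K = {u..v}" "u \<le> v" using pD(3)[OF xK(1)] by blast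
    have x: "x \<in> {a..b} - N" using pD(1,2)[OF xK(1)] xK by (auto simp: q_def)
    then have "K \<subseteq> ball x (r x)" using pD(4)[OF xK(1)] by (auto simp: \<gamma>_def)
    then have "u \<in> ball x (r x)" "v \<in> ball x (r x)" using uv by auto
    then show "f (Sup K) - f (Inf K) \<le> c * (Sup K - Inf K)"
      using r(2)[OF x, of u v] pD(1,2)[OF xK(1)] uv by auto
  qed
  also have "\<dots> \<le> (\<Sum>(x, K)\<in>p. c * (Sup K - Inf K))"
  proof (rule sum_mono2[OF fin])
    fix y assume "y \<in> p - (p - q)"
    then obtain x K where "y = (x, K)" "(x, K) \<in> p" by (cases y) auto
    then show "0 \<le> (case y of (x, K) \<Rightarrow> c * (Sup K - Inf K))"
      using pD(3) c(1) by fastforce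
  qed auto
  also have "\<dots> = c * (b - a)"
    using additive_tagged_division_1[OF ab p(1), of "\<lambda>x. c * x"] by (simp only: right_diff_distrib)
  also have "\<dots> \<le> e / 2" using c by simp
  finally show "f b \<le> f a + e" by simp
qed

lemma abs_cont_on_intervalD:
  assumes "abs_cont_on S f" "e > 0"
  obtains d where "d > 0" "\<And>s t. s \<le> t \<Longrightarrow> {s..t} \<subseteq> S \<Longrightarrow> t - s < d \<Longrightarrow> norm (f t - f s) < e"
proof -
  obtain d where d: "d > 0" "\<And>D. D division_of \<Union>D \<Longrightarrow> \<Union>D \<subseteq> S \<Longrightarrow> (\<Sum>I\<in>D. Sup I - Inf I) < d \<Longrightarrow>
      (\<Sum>I\<in>D. norm (f (Sup I) - f (Inf I))) < e"
    using abs_cont_onE[OF assms] by blast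
  have "norm (f t - f s) < e" if "s \<le> t" "{s..t} \<subseteq> S" "t - s < d" for s t
    using d(2)[of "{{s..t}}"] division_of_self[of s t] that by auto
  then show ?thesis using d(1) that by blast
qed

lemma abs_cont_on_imp_continuous_on:
  assumes "abs_cont_on {a..b} f"
  shows "continuous_on {a..b} f"
proof (rule continuous_onI)
  fix x e :: real assume x: "x \<in> {a..b}" and "e > 0"
  then obtain d where d: "d > 0"
    "\<And>s t. s \<le> t \<Longrightarrow> {s..t} \<subseteq> {a..b} \<Longrightarrow> t - s < d \<Longrightarrow> norm (f t - f s) < e"
    using abs_cont_on_intervalD[OF assms] by metis
  have "dist (f y) (f x) \<le> e" if "y \<in> {a..b}" "dist y x < d" for y
    using d(2)[of x y] d(2)[of y x] that x
    by (cases "x \<le> y") (auto simp: dist_norm norm_minus_commute)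
  then show "\<exists>d>0. \<forall>x'\<in>{a..b}. dist x' x < d \<longrightarrow> dist (f x') (f x) \<le> e"
    using d(1) by blast
qed

lemma division_of_interval:
  fixes D :: "real set set"
  assumes "D division_of S" "I \<in> D"
  shows "Inf I \<le> Sup I" "Inf I \<in> S" "Sup I \<in> S"
proof -
  obtain u v where "I = {u..v}" "I \<noteq> {}" "I \<subseteq> S"
    using division_ofD(2,3,4)[OF assms] by (metis box_real(2))
  then show "Inf I \<le> Sup I" "Inf I \<in> S" "Sup I \<in> S" by auto
qed

text \<open>Common source of the closure properties: Lipschitz functions, differences and inner
  products all have increments dominated by those of two absolutely continuous functions.\<close>

lemma abs_cont_on_bounded_increment:
  assumes f: "abs_cont_on S f" and g: "abs_cont_on S g" and C: "C \<ge> 0"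
    and le: "\<And>s t. s \<in> S \<Longrightarrow> t \<in> S \<Longrightarrow> norm (h t - h s) \<le> C * (norm (f t - f s) + norm (g t - g s))"
  shows "abs_cont_on S h"
  unfolding abs_cont_on_def
proof (intro allI impI)
  fix e :: real assume "e > 0"
  define e' where "e' = e / 2 / (C + 1)"
  have e': "e' > 0" and "(C + 1) * e' = e / 2" using \<open>e > 0\<close> C by (auto simp: e'_def divide_simps)
  have "C * (e' + e') < (C + 1) * (e' + e')" using e' by simp
  also have "\<dots> = e" using \<open>(C + 1) * e' = e / 2\<close> by (simp only: distrib_left)
  finally have Ce': "C * (e' + e') < e" .
  obtain d1 where d1: "d1 > 0" "\<And>D. D division_of \<Union>D \<Longrightarrow> \<Union>D \<subseteq> S \<Longrightarrow> (\<Sum>I\<in>D. Sup I - Inf I) < d1 \<Longrightarrow>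
      (\<Sum>I\<in>D. norm (f (Sup I) - f (Inf I))) < e'"
    using abs_cont_onE[OF f e'] by blast
  obtain d2 where d2: "d2 > 0" "\<And>D. D division_of \<Union>D \<Longrightarrow> \<Union>D \<subseteq> S \<Longrightarrow> (\<Sum>I\<in>D. Sup I - Inf I) < d2 \<Longrightarrow>
      (\<Sum>I\<in>D. norm (g (Sup I) - g (Inf I))) < e'"
    using abs_cont_onE[OF g e'] by blast
  have "(\<Sum>I\<in>D. norm (h (Sup I) - h (Inf I))) < e"
    if D: "D division_of \<Union>D \<and> \<Union>D \<subseteq> S \<and> (\<Sum>I\<in>D. Sup I - Inf I) < min d1 d2" for D
  proof -
    have "(\<Sum>I\<in>D. norm (h (Sup I) - h (Inf I)))
        \<le> (\<Sum>I\<in>D. C * (norm (f (Sup I) - f (Inf I)) + norm (g (Sup I) - g (Inf I))))"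
      using D division_of_interval[of D "\<Union>D"] by (intro sum_mono le) blast+
    also have "\<dots> = C * ((\<Sum>I\<in>D. norm (f (Sup I) - f (Inf I))) + (\<Sum>I\<in>D. norm (g (Sup I) - g (Inf I))))"
      by (simp only: sum.distrib sum_distrib_left[symmetric])
    also have "\<dots> \<le> C * (e' + e')"
      using d1(2)[of D] d2(2)[of D] D C by (intro mult_left_mono) auto
    finally show ?thesis using Ce' by simp
  qed
  then show "\<exists>\<delta>>0. \<forall>D. D division_of \<Union> D \<and> \<Union> D \<subseteq> S \<and> (\<Sum>I\<in>D. Sup I - Inf I) < \<delta> \<longrightarrow>
      (\<Sum>I\<in>D. norm (h (Sup I) - h (Inf I))) < e"
    using d1(1) d2(1) by (intro exI[of _ "min d1 d2"]) auto
qed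

lemma lipschitz_imp_abs_cont_on:
  assumes "L-lipschitz_on S f"
  shows "abs_cont_on S f"
proof -
  have id: "abs_cont_on S (\<lambda>t. t)"
    unfolding abs_cont_on_def
  proof (intro allI impI exI conjI, assumption, clarify)
    fix e and D :: "real set set" assume "D division_of \<Union>D" "(\<Sum>I\<in>D. Sup I - Inf I) < e"
    moreover have "(\<Sum>I\<in>D. norm (Sup I - Inf I)) = (\<Sum>I\<in>D. Sup I - Inf I)"
      using \<open>D division_of \<Union>D\<close> by (intro sum.cong) (auto dest: division_of_interval(1))
    ultimately show "(\<Sum>I\<in>D. norm (Sup I - Inf I)) < e" by simp
  qed
  show ?thesis
  proof (rule abs_cont_on_bounded_increment[OF id id lipschitz_on_nonneg[OF assms]])
    fix s t assume "s \<in> S" "t \<in> S"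
    then show "norm (f t - f s) \<le> L * (norm (t - s) + norm (t - s))"
      using lipschitz_onD[OF assms, of t s] mult_nonneg_nonneg[OF lipschitz_on_nonneg[OF assms] norm_ge_zero[of "t - s"]]
      by (simp add: dist_norm algebra_simps)
  qed
qed

lemma abs_cont_on_diff:
  assumes "abs_cont_on S f" "abs_cont_on S g"
  shows "abs_cont_on S (\<lambda>t. f t - g t)"
proof (rule abs_cont_on_bounded_increment[OF assms, of 1])
  fix s t
  show "norm ((f t - g t) - (f s - g s)) \<le> 1 * (norm (f t - f s) + norm (g t - g s))"
    using norm_triangle_ineq4[of "f t - f s" "g t - g s"] by (simp add: algebra_simps)
qed simp

lemma abs_cont_on_inner:
  fixes f g :: "real \<Rightarrow> 'a::real_inner"
  assumes f: "abs_cont_on {a..b} f" and g: "abs_cont_on {a..b} g"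
  shows "abs_cont_on {a..b} (\<lambda>t. f t \<bullet> g t)"
proof -
  have "compact (f ` {a..b})" "compact (g ` {a..b})"
    using assms by (auto intro!: compact_continuous_image abs_cont_on_imp_continuous_on)
  then obtain A B where "A > 0" "B > 0" and AB: "\<And>t. t \<in> {a..b} \<Longrightarrow> norm (f t) \<le> A"
    "\<And>t. t \<in> {a..b} \<Longrightarrow> norm (g t) \<le> B"
    by (metis bounded_pos compact_imp_bounded imageI)
  show ?thesis
  proof (rule abs_cont_on_bounded_increment[OF f g, of "A + B"])
    fix s t assume st: "s \<in> {a..b}" "t \<in> {a..b}"
    have "f t \<bullet> g t - f s \<bullet> g s = (f t - f s) \<bullet> g t + f s \<bullet> (g t - g s)"
      by (simp add: inner_diff_left inner_diff_right)
    then have "norm (f t \<bullet> g t - f s \<bullet> g s) \<le> norm (f t - f s) * norm (g t) + norm (f s) * norm (g t - g s)"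
      using Cauchy_Schwarz_ineq2[of "f t - f s" "g t"] Cauchy_Schwarz_ineq2[of "f s" "g t - g s"]
      unfolding real_norm_def by linarith
    also have "\<dots> \<le> norm (f t - f s) * B + A * norm (g t - g s)"
      using AB st by (intro add_mono mult_left_mono mult_right_mono) auto
    also have "\<dots> \<le> (A + B) * (norm (f t - f s) + norm (g t - g s))"
      using \<open>A > 0\<close> \<open>B > 0\<close> by (simp add: algebra_simps)
    finally show "norm (f t \<bullet> g t - f s \<bullet> g s) \<le> (A + B) * (norm (f t - f s) + norm (g t - g s))" .
  qed (use \<open>A > 0\<close> \<open>B > 0\<close> in auto)
qed

text \<open>Only interior derivatives are asked for: at the hitting time the direction of the
  control has no limit and the velocity is not differentiable, yet a bound inside the interval gives
  the Lipschitz property up to that endpoint.\<close>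

lemma bounded_vector_derivative_imp_lipschitz_on:
  fixes f :: "real \<Rightarrow> 'a::real_inner"
  assumes cont: "continuous_on {a..b} f" and L: "L \<ge> 0"
    and der: "\<And>t. t \<in> {a<..<b} \<Longrightarrow> (f has_vector_derivative f' t) (at t)"
    and le: "\<And>t. t \<in> {a<..<b} \<Longrightarrow> norm (f' t) \<le> L"
  shows "L-lipschitz_on {a..b} f"
proof (rule lipschitz_on_leI[OF _ L])
  fix s t assume st: "s \<in> {a..b}" "t \<in> {a..b}" "s \<le> t"
  show "dist (f s) (f t) \<le> L * dist s t"
  proof (cases "s = t")
    case False
    have "continuous_on {s..t} f" using cont st by (auto intro: continuous_on_subset)
    then obtain r where r: "r \<in> {s<..<t}" "norm (f t - f s) \<le> norm ((t - s) *\<^sub>R f' r)"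
      using mvt_general[of s t f "\<lambda>r h. h *\<^sub>R f' r"] der st False
      by (auto simp: has_vector_derivative_def)
    have "norm ((t - s) *\<^sub>R f' r) \<le> (t - s) * L"
      using le[of r] r(1) st by (auto intro: mult_left_mono)
    then show ?thesis
      using r(2) st by (simp add: dist_norm norm_minus_commute mult.commute)
  qed simp
qed

text \<open>Along the extremal the function
  \<open>\<psi> \<bullet> \<eta> - \<psi>' \<bullet> \<delta> - \<integral>\<^sub>0\<^sup>t x \<bullet> \<delta>\<close>, where \<open>\<delta>\<close> and \<open>\<eta>\<close> are the
  variations of \<open>x\<close> and \<open>y\<close>, has derivative \<open>\<psi> \<bullet> (u' - u) \<le> 0\<close>; since the costate vanishes
  at \<open>T\<close>, the first variation of the convex functional is nonnegative.\<close>

lemma optimal_if_costate: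
  assumes sym: "\<And>v w. (K *v v) \<bullet> w = v \<bullet> (K *v w)"
    and adm: "admissible K x0 y0 x y u" and T: "T \<ge> 0"
    and ac\<psi>: "abs_cont_on {0..T} \<psi>" "abs_cont_on {0..T} \<psi>'"
    and der\<psi>: "\<And>t. t \<in> {0<..<T} \<Longrightarrow> (\<psi> has_vector_derivative \<psi>' t) (at t)"
    and der\<psi>': "\<And>t. t \<in> {0<..<T} \<Longrightarrow> (\<psi>' has_vector_derivative (K *v \<psi> t - x t)) (at t)"
    and fin: "\<psi> T = 0" "\<psi>' T = 0" and u: "\<And>t. t \<in> {0<..<T} \<Longrightarrow> u t = sgn (\<psi> t)"
    and x: "\<And>t. t \<ge> T \<Longrightarrow> x t = 0"
  shows "optimal K x0 y0 x y u"
  unfolding optimal_def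
proof (intro conjI allI impI adm)
  fix x' y' u' assume adm': "admissible K x0 y0 x' y' u'"
  define \<delta> where "\<delta> t = x' t - x t" for t
  define \<eta> where "\<eta> t = y' t - y t" for t
  have ac: "abs_cont_on {0..T} x" "abs_cont_on {0..T} y" "abs_cont_on {0..T} x'" "abs_cont_on {0..T} y'"
    using adm adm' T by (auto simp: admissible_def)
  have ac\<delta>: "abs_cont_on {0..T} \<delta>" "abs_cont_on {0..T} \<eta>"
    unfolding \<delta>_def \<eta>_def by (intro abs_cont_on_diff ac)+
  note cont = ac[THEN abs_cont_on_imp_continuous_on] ac\<delta>[THEN abs_cont_on_imp_continuous_on]
  have cont_i: "continuous_on {0..T} (\<lambda>t. x t \<bullet> \<delta> t)"
    by (intro continuous_intros cont)
  define J where "J t = integral {0..t} (\<lambda>t. x t \<bullet> \<delta> t)" for t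
  have derJ: "(J has_real_derivative x t \<bullet> \<delta> t) (at t)" if "t \<in> {0<..<T}" for t
    using integral_has_real_derivative[OF cont_i, of t] that at_within_Icc_at[of 0 t T]
    unfolding J_def by auto
  have "bounded ((\<lambda>t. x t \<bullet> \<delta> t) ` {0..T})"
    by (intro compact_imp_bounded compact_continuous_image cont_i) auto
  then obtain B where B: "B > 0" "\<And>t. t \<in> {0..T} \<Longrightarrow> norm (x t \<bullet> \<delta> t) \<le> B"
    unfolding bounded_pos by blast
  have "B-lipschitz_on {0..T} J"
  proof (rule bounded_vector_derivative_imp_lipschitz_on)
    show "continuous_on {0..T} J"
      unfolding J_def by (intro indefinite_integral_continuous_1 integrable_continuous_real cont_i)
  qed (use B derJ in \<open>auto simp: has_real_derivative_iff_has_vector_derivative\<close>)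
  then have acJ: "abs_cont_on {0..T} J" by (rule lipschitz_imp_abs_cont_on)
  have "AE t in lebesgue. t \<in> {0..} \<longrightarrow> (x has_vector_derivative y t) (at t) \<and>
      (y has_vector_derivative (K *v x t + u t)) (at t) \<and> (x' has_vector_derivative y' t) (at t) \<and>
      (y' has_vector_derivative (K *v x' t + u' t)) (at t)"
    using adm adm' unfolding admissible_def
    by (subst AE_restrict_space_iff[symmetric]) auto
  then obtain N where N: "N \<in> null_sets lebesgue"
    and derN: "\<And>t. t \<in> {0..} - N \<Longrightarrow> (x has_vector_derivative y t) (at t) \<and>
      (y has_vector_derivative (K *v x t + u t)) (at t) \<and> (x' has_vector_derivative y' t) (at t) \<and>
      (y' has_vector_derivative (K *v x' t + u' t)) (at t)"
    by (elim AE_E3) auto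
  define F where "F t = (\<psi> t \<bullet> \<eta> t - \<psi>' t \<bullet> \<delta> t) - J t" for t
  have "F T \<le> F 0"
  proof (rule abs_cont_on_nonincreasing[OF _ T])
    show "abs_cont_on {0..T} F"
      unfolding F_def by (intro abs_cont_on_diff abs_cont_on_inner ac\<psi> ac\<delta> acJ)
    \<comment> \<open>The costate equations hold only inside the interval, so its endpoints join the
      exceptional null set.\<close>
    show "negligible (N \<union> {0, T})"
      using N by (intro negligible_Un) (auto simp: negligible_iff_null_sets)
    fix t assume t: "t \<in> {0..T} - (N \<union> {0, T})"
    then have t': "t \<in> {0<..<T}" by auto
    have "t \<in> {0..} - N" using t by auto
    note d = derN[OF this]
    have d\<delta>: "(\<delta> has_vector_derivative \<eta> t) (at t)"
      unfolding \<delta>_def \<eta>_def using d by (intro has_vector_derivative_diff) auto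
    have d\<eta>: "(\<eta> has_vector_derivative (K *v \<delta> t + (u' t - u t))) (at t)"
    proof -
      have "(\<eta> has_vector_derivative ((K *v x' t + u' t) - (K *v x t + u t))) (at t)"
        unfolding \<eta>_def using d by (intro has_vector_derivative_diff) auto
      then show ?thesis by (simp add: \<delta>_def matrix_vector_mult_diff_distrib algebra_simps)
    qed
    have "(F has_vector_derivative ((\<psi> t \<bullet> (K *v \<delta> t + (u' t - u t)) + \<psi>' t \<bullet> \<eta> t) -
        (\<psi>' t \<bullet> \<eta> t + (K *v \<psi> t - x t) \<bullet> \<delta> t) - x t \<bullet> \<delta> t)) (at t)"
      unfolding F_def
      by (intro has_vector_derivative_diff
          bounded_bilinear.has_vector_derivative[OF bounded_bilinear_inner]
          der\<psi>[OF t'] der\<psi>'[OF t'] d\<delta> d\<eta>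
          derJ[OF t', unfolded has_real_derivative_iff_has_vector_derivative])
    \<comment> \<open>The two \<open>K\<close> terms cancel by symmetry of \<open>K\<close>, the two
      terms in \<open>x t\<close> by the choice of \<open>J\<close>; only the variation of the
      control survives.\<close>
    moreover have "(\<psi> t \<bullet> (K *v \<delta> t + (u' t - u t)) + \<psi>' t \<bullet> \<eta> t) -
        (\<psi>' t \<bullet> \<eta> t + (K *v \<psi> t - x t) \<bullet> \<delta> t) - x t \<bullet> \<delta> t = \<psi> t \<bullet> (u' t - u t)"
      by (simp add: inner_add_right inner_diff_left sym)
    \<comment> \<open>The maximum condition: over the unit ball the inner product with
      \<open>\<psi> t\<close> is at most \<open>norm (\<psi> t)\<close>, a value that
      \<open>sgn (\<psi> t)\<close> attains. At a zero of the costate both sides vanish.\<close>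
    moreover have "\<psi> t \<bullet> (u' t - u t) \<le> 0"
    proof -
      have "\<psi> t \<bullet> u t = norm (\<psi> t)"
        using u[OF t']
        by (cases "\<psi> t = 0") (simp_all add: sgn_div_norm dot_square_norm power2_eq_square)
      moreover have "\<psi> t \<bullet> u' t \<le> norm (\<psi> t) * norm (u' t)" by (rule norm_cauchy_schwarz)
      moreover have "\<dots> \<le> norm (\<psi> t)"
        using adm' t' by (auto simp: admissible_def intro: mult_left_le)
      ultimately show ?thesis by (simp add: inner_diff_right)
    qed
    ultimately show "\<exists>d\<le>0. (F has_real_derivative d) (at t)"
      by (auto simp: has_real_derivative_iff_has_vector_derivative)
  qed
  moreover have "F 0 = 0"
    using adm adm' by (simp add: F_def J_def \<delta>_def \<eta>_def admissible_def)
  \<comment> \<open>The costate vanishes at \<open>T\<close>, so \<open>F T = - J T\<close> wherever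
    the competitor happens to be at that time.\<close>
  ultimately have J: "J T \<ge> 0" by (simp add: F_def fin)
  define I where "I = integral {0..T} (\<lambda>t. x t \<bullet> x t)"
  define I' where "I' = integral {0..T} (\<lambda>t. x' t \<bullet> x' t)"
  have I: "((\<lambda>t. x t \<bullet> x t) has_integral I) {0..T}" "((\<lambda>t. x' t \<bullet> x' t) has_integral I') {0..T}"
    unfolding I_def I'_def
    by (intro integrable_integral integrable_continuous_real continuous_intros cont)+
  have "((\<lambda>t. x t \<bullet> x t + 2 * (x t \<bullet> \<delta> t)) has_integral (I + 2 * J T)) {0..T}"
    unfolding J_def
    by (intro has_integral_add has_integral_mult_right I integrable_integral integrable_continuous_real cont_i)
  then have "I + 2 * J T \<le> I'"
  proof (rule has_integral_le[OF _ I(2)])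
    fix t
    have "x' t \<bullet> x' t = x t \<bullet> x t + 2 * (x t \<bullet> \<delta> t) + \<delta> t \<bullet> \<delta> t"
      by (simp add: \<delta>_def algebra_simps inner_commute)
    then show "x t \<bullet> x t + 2 * (x t \<bullet> \<delta> t) \<le> x' t \<bullet> x' t"
      using inner_ge_zero[of "\<delta> t"] by linarith
  qed
  then have "I \<le> I'" using J by simp
  \<comment> \<open>The extremal costs nothing after \<open>T\<close>, so comparing on
    \<open>{0..T}\<close> settles the infinite horizon, including competitors of infinite
    cost.\<close>
  have "cost x = (\<integral>\<^sup>+t. ennreal (x t \<bullet> x t) * indicator {0..T} t \<partial>lebesgue)"
    unfolding cost_def by (intro nn_integral_cong) (auto simp: indicator_def x)
  also have "\<dots> = ennreal I"
    using nn_integral_has_integral_lebesgue'[OF _ I(1)] by (simp add: nn_integral_completion)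
  also have "\<dots> \<le> ennreal I'" using \<open>I \<le> I'\<close> by (rule ennreal_leI)
  also have "\<dots> = (\<integral>\<^sup>+t. ennreal (x' t \<bullet> x' t) * indicator {0..T} t \<partial>lebesgue)"
    using nn_integral_has_integral_lebesgue'[OF _ I(2)] by (simp add: nn_integral_completion)
  also have "\<dots> \<le> cost x'"
    unfolding cost_def by (intro nn_integral_mono) (auto simp: indicator_def)
  finally show "cost x \<le> cost x'" .
qed

section \<open>Double integrals and directions\<close>

lemma power_antiderivative:
  "((\<lambda>r. r ^ (n + 1) / real (n + 1)) has_real_derivative r ^ n) (at r within S)" for r :: real
proof -
  have "((\<lambda>r. r ^ Suc n) has_real_derivative real (Suc n) * r ^ n) (at r within S)"
    using DERIV_pow[of "Suc n" r S] by simp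
  from DERIV_cdivide[OF this, of "real (n + 1)"] show ?thesis by simp
qed

lemma has_integral_weighted_power:
  fixes s C :: real
  assumes "s \<ge> 0"
  shows "((\<lambda>r. (s - r) * (C * r ^ n)) has_integral C * s ^ (n + 2) / (real (n + 1) * real (n + 2))) {0..s}"
proof -
  define P where "P r = C * (s * (r ^ (n + 1) / real (n + 1)) - r ^ (n + 2) / real (n + 2))" for r :: real
  have "(P has_real_derivative C * (s * r ^ n - r ^ (n + 1))) (at r within {0..s})" for r
    unfolding P_def
    using power_antiderivative[of n r "{0..s}"] power_antiderivative[of "n + 1" r "{0..s}"]
    by (intro DERIV_cmult DERIV_diff) (simp_all add: add.commute)
  moreover have "C * (s * r ^ n - r ^ (n + 1)) = (s - r) * (C * r ^ n)" for r
    by (simp add: algebra_simps)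
  ultimately have "(P has_real_derivative (s - r) * (C * r ^ n)) (at r within {0..s})" for r
    by (simp only:)
  then have "((\<lambda>r. (s - r) * (C * r ^ n)) has_integral P s - P 0) {0..s}"
    using assms by (intro fundamental_theorem_of_calculus)
      (auto simp: has_real_derivative_iff_has_vector_derivative)
  moreover have "P s - P 0 = C * s ^ (n + 2) / (real (n + 1) * real (n + 2))"
  proof -
    have "P s - P 0 = C * s ^ (n + 2) * (1 / (real n + 1) - 1 / (real n + 2))"
      by (simp add: P_def algebra_simps)
    also have "1 / (real n + 1) - 1 / (real n + 2) = 1 / (real (n + 1) * real (n + 2))"
      by (simp add: field_simps)
    finally show ?thesis by simp
  qed
  ultimately show ?thesis by simp
qed

text \<open>Cauchy's formula for the repeated integral: the function with second derivative
  \<open>f\<close> that vanishes at 0 together with its first derivative. As a single weighted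
  integral it is easy to estimate.\<close>

definition double_integral :: "(real \<Rightarrow> 'a::euclidean_space) \<Rightarrow> real \<Rightarrow> 'a" where
  "double_integral f s = integral {0..s} (\<lambda>r. (s - r) *\<^sub>R f r)"

text \<open>This is where the contraction gains its factors: 1 / 12 for \<open>n = 2\<close> and 1 /
  30 for \<open>n = 4\<close>.\<close>

lemma norm_double_integral_le:
  assumes f: "continuous_on {0..s} f" and s: "s \<ge> 0"
    and le: "\<And>r. r \<in> {0..s} \<Longrightarrow> norm (f r) \<le> C * r ^ n"
  shows "norm (double_integral f s) \<le> C * s ^ (n + 2) / (real (n + 1) * real (n + 2))"
proof -
  have "norm (double_integral f s) \<le> integral {0..s} (\<lambda>r. (s - r) * (C * r ^ n))"
    unfolding double_integral_def
  proof (rule integral_norm_bound_integral)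
    show "(\<lambda>r. (s - r) *\<^sub>R f r) integrable_on {0..s}"
      by (intro integrable_continuous_real continuous_intros f)
    show "(\<lambda>r. (s - r) * (C * r ^ n)) integrable_on {0..s}"
      using has_integral_weighted_power[OF s] by blast
    fix r assume "r \<in> {0..s}"
    then show "norm ((s - r) *\<^sub>R f r) \<le> (s - r) * (C * r ^ n)"
      using le[of r] by (auto intro: mult_left_mono)
  qed
  also have "\<dots> = C * s ^ (n + 2) / (real (n + 1) * real (n + 2))"
    using has_integral_weighted_power[OF s] by (rule integral_unique)
  finally show ?thesis .
qed

lemma norm_integral_power_le:
  fixes f :: "real \<Rightarrow> 'a::euclidean_space"
  assumes f: "continuous_on {0..s} f" and s: "s \<ge> 0"
    and le: "\<And>r. r \<in> {0..s} \<Longrightarrow> norm (f r) \<le> C * r ^ n"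
  shows "norm (integral {0..s} f) \<le> C * s ^ (n + 1) / real (n + 1)"
proof -
  have *: "((\<lambda>r. C * r ^ n) has_integral C * (s ^ (n + 1) / real (n + 1))) {0..s}"
  proof (rule has_integral_mult_right)
    have "((\<lambda>r. r ^ n) has_integral s ^ (n + 1) / real (n + 1) - 0 ^ (n + 1) / real (n + 1)) {0..s}"
      by (intro fundamental_theorem_of_calculus s
          power_antiderivative[unfolded has_real_derivative_iff_has_vector_derivative])
    then show "((\<lambda>r. r ^ n) has_integral s ^ (n + 1) / real (n + 1)) {0..s}" by simp
  qed
  have "norm (integral {0..s} f) \<le> integral {0..s} (\<lambda>r. C * r ^ n)"
    using le by (intro integral_norm_bound_integral integrable_continuous_real f continuous_intros) auto
  also have "\<dots> = C * (s ^ (n + 1) / real (n + 1))" using * by (rule integral_unique)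
  finally show ?thesis by simp
qed

lemma double_integral_diff:
  assumes "continuous_on {0..s} f" "continuous_on {0..s} g"
  shows "double_integral (\<lambda>r. f r - g r) s = double_integral f s - double_integral g s"
  unfolding double_integral_def scaleR_diff_right
  by (intro integral_diff integrable_continuous_real continuous_intros assms)

text \<open>Splitting the weight \<open>s - r\<close> moves the parameter outside the integrals, so
  the product rule suffices in place of differentiation under the integral sign.\<close>

lemma double_integral_has_vector_derivative:
  assumes f: "continuous_on {0..S} f" and s: "s \<in> {0..S}"
  shows "(double_integral f has_vector_derivative integral {0..s} f) (at s within {0..S})"
proof -
  have c: "continuous_on {0..S} (\<lambda>r. r *\<^sub>R f r)" by (intro continuous_intros f)
  have eq: "double_integral f t = t *\<^sub>R integral {0..t} f - integral {0..t} (\<lambda>r. r *\<^sub>R f r)" if "t \<in> {0..S}" for t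
  proof -
    have ft: "continuous_on {0..t} f" using f that by (auto intro: continuous_on_subset)
    have "double_integral f t = integral {0..t} (\<lambda>r. t *\<^sub>R f r) - integral {0..t} (\<lambda>r. r *\<^sub>R f r)"
      unfolding double_integral_def scaleR_diff_left
      by (intro integral_diff integrable_continuous_real continuous_intros ft)
    then show ?thesis by simp
  qed
  have "((\<lambda>t. t *\<^sub>R integral {0..t} f - integral {0..t} (\<lambda>r. r *\<^sub>R f r)) has_vector_derivative
      (s *\<^sub>R f s + 1 *\<^sub>R integral {0..s} f - s *\<^sub>R f s)) (at s within {0..S})"
    by (intro has_vector_derivative_diff has_vector_derivative_scaleR
        integral_has_vector_derivative[OF f s] integral_has_vector_derivative[OF c s])
      (auto intro: derivative_eq_intros)
  then have "((\<lambda>t. t *\<^sub>R integral {0..t} f - integral {0..t} (\<lambda>r. r *\<^sub>R f r)) has_vector_derivative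
      integral {0..s} f) (at s within {0..S})" by simp
  then show ?thesis
    by (rule has_vector_derivative_transform[OF s _, rotated]) (simp add: eq)
qed

lemma continuous_on_double_integral:
  assumes "continuous_on {0..S} f"
  shows "continuous_on {0..S} (double_integral f)"
  using double_integral_has_vector_derivative[OF assms]
  unfolding continuous_on_eq_continuous_within by (metis has_vector_derivative_continuous)

text \<open>By the law of cosines and \<open>2 * A * B \<le> A\<^sup>2 + B\<^sup>2\<close>, the
  squared distance of \<open>a\<close> and \<open>b\<close> is at least \<open>A * B\<close> times
  that of their directions. The constant \<open>1 / m\<close> is half of what the triangle
  inequality yields; with the weight 20 used below, the doubled constant would give 264 / 240 >
  1.\<close>

lemma norm_sgn_diff_le:
  fixes a b :: "'a::real_inner"
  assumes m: "m > 0" and a: "m \<le> norm a" and b: "m \<le> norm b"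
  shows "norm (sgn a - sgn b) \<le> norm (a - b) / m"
proof -
  define A where "A = norm a"
  define B where "B = norm b"
  have AB: "A > 0" "B > 0" "A \<ge> m" "B \<ge> m" using assms by (auto simp: A_def B_def)
  define c where "c = a \<bullet> b"
  have c: "c \<le> A * B" unfolding A_def B_def c_def by (rule norm_cauchy_schwarz)
  have inn: "a \<bullet> a = A\<^sup>2" "b \<bullet> b = B\<^sup>2" by (simp_all add: A_def B_def dot_square_norm)
  have "(norm (sgn a - sgn b))\<^sup>2 = 2 - 2 * (c / (A * B))"
  proof -
    have "a \<noteq> 0" "b \<noteq> 0" using AB by (auto simp: A_def B_def)
    then have "sgn a \<bullet> sgn a = 1" "sgn b \<bullet> sgn b = 1" by (simp_all add: dot_square_norm norm_sgn)
    moreover have "sgn a \<bullet> sgn b = c / (A * B)"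
      by (simp add: sgn_div_norm A_def B_def c_def field_simps)
    ultimately show ?thesis
      by (simp add: power2_norm_eq_inner inner_diff_left inner_diff_right inner_commute)
  qed
  moreover have "(norm (a - b))\<^sup>2 = A\<^sup>2 + B\<^sup>2 - 2 * c"
    by (simp add: power2_norm_eq_inner inner_diff_left inner_diff_right inner_commute inn c_def)
  moreover have "m\<^sup>2 * (2 - 2 * (c / (A * B))) \<le> A\<^sup>2 + B\<^sup>2 - 2 * c"
  proof -
    have "m\<^sup>2 \<le> A * B" unfolding power2_eq_square using AB m by (intro mult_mono) auto
    moreover have "2 - 2 * (c / (A * B)) \<ge> 0" using c AB by (simp add: divide_le_eq)
    ultimately have "m\<^sup>2 * (2 - 2 * (c / (A * B))) \<le> (A * B) * (2 - 2 * (c / (A * B)))"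
      by (rule mult_right_mono)
    also have "\<dots> = 2 * (A * B) - 2 * c" using AB by (simp add: algebra_simps)
    also have "\<dots> \<le> A\<^sup>2 + B\<^sup>2 - 2 * c"
      using sum_squares_bound[of A B] by simp
    finally show ?thesis .
  qed
  ultimately have "(m * norm (sgn a - sgn b))\<^sup>2 \<le> (norm (a - b))\<^sup>2"
    by (simp add: power_mult_distrib)
  then have "m * norm (sgn a - sgn b) \<le> norm (a - b)"
    by (rule power2_le_imp_le) simp
  then show ?thesis using m by (simp add: field_simps)
qed

text \<open>Made for spirals, which are given by formulas in \<open>ln r\<close>, continuous only
  for positive \<open>r\<close>. The bound at \<open>r = 0\<close> forces \<open>h 0 = 0\<close>,
  and the positive power gives the limit.\<close>

lemma continuous_on_Icc_if_power_bound:
  fixes h :: "real \<Rightarrow> 'a::real_normed_vector"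
  assumes c: "continuous_on {0<..S} h" and n: "n > 0"
    and le: "\<And>r. r \<in> {0..S} \<Longrightarrow> norm (h r) \<le> C * r ^ n"
  shows "continuous_on {0..S} h"
  unfolding continuous_on_eq_continuous_within
proof
  fix x assume x: "x \<in> {0..S}"
  show "continuous (at x within {0..S}) h"
  proof (cases "x = 0")
    case True
    have "h 0 = 0" using le[of 0] n x True by (simp add: power_0_left)
    have "((\<lambda>r. C * r ^ n) \<longlongrightarrow> C * 0 ^ n) (at 0 within {0..S})"
      by (intro tendsto_intros)
    then have "((\<lambda>r. C * r ^ n) \<longlongrightarrow> 0) (at 0 within {0..S})" using n by (simp add: power_0_left)
    then have "(h \<longlongrightarrow> 0) (at 0 within {0..S})"
      by (rule Lim_null_comparison[rotated]) (auto simp: eventually_at_filter le)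
    then show ?thesis using True \<open>h 0 = 0\<close> by (simp add: continuous_within)
  next
    case False
    then have "x \<in> {0<..S}" using x by auto
    moreover have "at x within {0..S} = at x within {0<..S}"
      using False x by (intro at_within_nhd[of x "{0<..}"]) auto
    ultimately show ?thesis using c by (simp add: continuous_on_eq_continuous_within)
  qed
qed

section \<open>The perturbed spiral as a fixed point\<close>

text \<open>The unknowns are rescaled to \<open>X - X0 = 20 s\<^sup>4 P\<close> and \<open>\<Psi> - \<Psi>0 = s\<^sup>6 Q\<close>, with
  \<open>(P, Q)\<close> a bounded continuous function of \<open>ln s\<close>; a function of \<open>s\<close> itself would not do, as
  spirals have no limit at \<open>0\<close>. The weight \<open>20\<close> balances the two off-diagonal Lipschitz constants
  \<open>132 / (12 * 20)\<close> and \<open>20 / 30\<close>, and \<open>1 / 2772 = 1 / 126 - 1 / 132\<close>, so that the ball of radius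
  \<open>R\<close> keeps \<open>\<parallel>\<Psi>\<parallel>\<close> above \<open>s\<^sup>4 / 132\<close>.\<close>

locale perturbed_spiral =
  fixes A :: "'a::euclidean_space \<Rightarrow> 'a" and X0 \<Psi>0 :: "real \<Rightarrow> 'a" and a c R S :: real
  assumes lin: "linear A" and a: "a > 0" "\<And>z. norm (A z) \<le> a * norm z" and c: "c \<ge> 0"
    and cont0: "continuous_on {0..S} X0" "continuous_on {0..S} \<Psi>0"
    and X0: "\<And>s. s \<in> {0..S} \<Longrightarrow> norm (X0 s) \<le> c * s ^ 2"
    and \<Psi>0: "\<And>s. s \<in> {0..S} \<Longrightarrow> norm (\<Psi>0 s) = s ^ 4 / 126"
    and R: "R = 10 * (a * c + a)"
    and S: "S > 0" "S \<le> 1" "10 * a * S \<le> 1" "2772 * R * S \<le> 1"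
begin

text \<open>At \<open>r = 0\<close> the value of \<open>w\<close> at \<open>ln 0\<close> is
  arbitrary, but the power of \<open>r\<close> annihilates it.\<close>

definition p :: "(real \<Rightarrow>\<^sub>C ('a \<times> 'a)) \<Rightarrow> real \<Rightarrow> 'a" where
  "p w r = (20 * r ^ 4) *\<^sub>R fst (w (ln r))"

definition q :: "(real \<Rightarrow>\<^sub>C ('a \<times> 'a)) \<Rightarrow> real \<Rightarrow> 'a" where
  "q w r = r ^ 6 *\<^sub>R snd (w (ln r))"

text \<open>With \<open>G\<close>, the right-hand side of the system for the corrections alone: the
  unperturbed equations \<open>X0'' = sgn \<Psi>0\<close> and \<open>\<Psi>0'' = - X0\<close> have
  been subtracted.\<close>

definition F :: "(real \<Rightarrow>\<^sub>C ('a \<times> 'a)) \<Rightarrow> real \<Rightarrow> 'a" where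
  "F w r = A (X0 r + p w r) + (sgn (\<Psi>0 r + q w r) - sgn (\<Psi>0 r))"

definition G :: "(real \<Rightarrow>\<^sub>C ('a \<times> 'a)) \<Rightarrow> real \<Rightarrow> 'a" where
  "G w r = A (\<Psi>0 r + q w r) - p w r"

text \<open>Integrates the equations twice and divides by the weights of \<open>p\<close> and
  \<open>q\<close>. The minimum freezes the value for \<open>\<tau>\<close> beyond
  \<open>ln S\<close>, which makes \<open>\<Phi> w\<close> a function on the whole line.\<close>

definition \<Phi> :: "(real \<Rightarrow>\<^sub>C ('a \<times> 'a)) \<Rightarrow> real \<Rightarrow> 'a \<times> 'a" where
  "\<Phi> w \<tau> = (let s = min S (exp \<tau>) in (double_integral (F w) s /\<^sub>R (20 * s ^ 4), double_integral (G w) s /\<^sub>R s ^ 6))"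

lemma R_pos: "R > 0"
  using a c by (simp add: R add_nonneg_pos)

lemma small: "r \<in> {0..S} \<Longrightarrow> a * r ^ 2 \<le> 1 / 10" "r \<in> {0..S} \<Longrightarrow> R * r ^ 2 \<le> 1 / 2772"
proof -
  assume r: "r \<in> {0..S}"
  have "r ^ 2 \<le> S * 1" unfolding power2_eq_square using r S by (intro mult_mono) auto
  then have "a * r ^ 2 \<le> a * S" "R * r ^ 2 \<le> R * S"
    using a R_pos by (auto intro: mult_left_mono)
  then show "a * r ^ 2 \<le> 1 / 10" "R * r ^ 2 \<le> 1 / 2772" using S by auto
qed

lemma p_diff: "r \<ge> 0 \<Longrightarrow> norm (p w r - p v r) \<le> 20 * norm (w - v) * r ^ 4"
proof -
  have "norm (fst (w (ln r)) - fst (v (ln r))) \<le> norm (w - v)"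
    using norm_bounded[of "w - v" "ln r"] unfolding minus_bcontfun.rep_eq
    by (metis fst_diff norm_fst_le order_trans prod.collapse)
  then have "20 * r ^ 4 * norm (fst (w (ln r)) - fst (v (ln r))) \<le> 20 * r ^ 4 * norm (w - v)"
    by (intro mult_left_mono) auto
  then show ?thesis by (simp add: p_def flip: scaleR_diff_right) (simp add: mult_ac)
qed

lemma q_diff: "r \<ge> 0 \<Longrightarrow> norm (q w r - q v r) \<le> norm (w - v) * r ^ 6"
proof -
  have "norm (snd (w (ln r)) - snd (v (ln r))) \<le> norm (w - v)"
    using norm_bounded[of "w - v" "ln r"] unfolding minus_bcontfun.rep_eq
    by (metis snd_diff norm_snd_le order_trans prod.collapse)
  then have "r ^ 6 * norm (snd (w (ln r)) - snd (v (ln r))) \<le> r ^ 6 * norm (w - v)"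
    by (intro mult_left_mono) auto
  then show ?thesis by (simp add: q_def flip: scaleR_diff_right) (simp add: mult_ac)
qed

lemma p_zero [simp]: "p 0 r = 0" and q_zero [simp]: "q 0 r = 0"
  by (simp_all add: p_def q_def)

lemma p_bound: "norm w \<le> R \<Longrightarrow> r \<ge> 0 \<Longrightarrow> norm (p w r) \<le> 20 * R * r ^ 4"
  using p_diff[of r w 0] mult_right_mono[of "norm w" R "r ^ 4"] by simp

lemma q_bound: "norm w \<le> R \<Longrightarrow> r \<ge> 0 \<Longrightarrow> norm (q w r) \<le> R * r ^ 6"
  using q_diff[of r w 0] mult_right_mono[of "norm w" R "r ^ 6"] by simp

lemma costate_lower: "norm w \<le> R \<Longrightarrow> r \<in> {0..S} \<Longrightarrow> r ^ 4 / 132 \<le> norm (\<Psi>0 r + q w r)"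
proof -
  assume w: "norm w \<le> R" and r: "r \<in> {0..S}"
  have "R * r ^ 6 = (R * r ^ 2) * r ^ 4" by (simp flip: power_add)
  also have "\<dots> \<le> 1 / 2772 * r ^ 4" using small(2)[OF r] by (intro mult_right_mono) auto
  finally have "norm (q w r) \<le> 1 / 2772 * r ^ 4" using q_bound[OF w, of r] r by simp
  then show ?thesis
    using \<Psi>0[OF r] norm_triangle_ineq2[of "\<Psi>0 r" "- q w r"] by simp
qed

text \<open>The order 6 of \<open>q\<close> outweighs the Lipschitz constant
  \<open>132 / r ^ 4\<close> and leaves order 2. At \<open>r = 0\<close> that constant is
  meaningless, but both directions coincide there.\<close>

lemma sgn_diff:
  assumes w: "norm w \<le> R" and v: "norm v \<le> R" and r: "r \<in> {0..S}"
  shows "norm (sgn (\<Psi>0 r + q w r) - sgn (\<Psi>0 r + q v r)) \<le> 132 * norm (w - v) * r ^ 2"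
proof (cases "r = 0")
  case True
  then show ?thesis by (simp add: q_def)
next
  case False
  then have "r > 0" using r by simp
  then have "norm (sgn (\<Psi>0 r + q w r) - sgn (\<Psi>0 r + q v r)) \<le> norm (q w r - q v r) / (r ^ 4 / 132)"
    using norm_sgn_diff_le[OF _ costate_lower[OF w r] costate_lower[OF v r]] by simp
  also have "\<dots> \<le> norm (w - v) * r ^ 6 / (r ^ 4 / 132)"
    using q_diff[of r w v] \<open>r > 0\<close> by (intro divide_right_mono) auto
  also have "\<dots> = 132 * norm (w - v) * r ^ 2"
    using \<open>r > 0\<close> by (simp add: field_simps flip: power_add)
  finally show ?thesis .
qed

text \<open>Here 134 = 132 + 20 / 10: the directions contribute 132, and the linear part, two orders
  higher, is absorbed through \<open>a * r ^ 2 \<le> 1 / 10\<close>. The 201 / 10 = 20 + 1 / 10 of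
  \<open>G_diff\<close> arises likewise, with \<open>p\<close> as the main term.\<close>

lemma F_diff:
  assumes w: "norm w \<le> R" and v: "norm v \<le> R" and r: "r \<in> {0..S}"
  shows "norm (F w r - F v r) \<le> 134 * norm (w - v) * r ^ 2"
proof -
  have "F w r - F v r = A (p w r - p v r) + (sgn (\<Psi>0 r + q w r) - sgn (\<Psi>0 r + q v r))"
    by (simp add: F_def linear_diff[OF lin] linear_add[OF lin])
  then have "norm (F w r - F v r) \<le> norm (A (p w r - p v r)) + 132 * norm (w - v) * r ^ 2"
    using norm_triangle_le[OF add_left_mono[OF sgn_diff[OF w v r]]] by simp
  also have "norm (A (p w r - p v r)) \<le> a * (20 * norm (w - v) * r ^ 4)"
    using a(2)[of "p w r - p v r"] p_diff[of r w v] a(1) r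
    by (meson atLeastAtMost_iff mult_left_mono order_trans less_imp_le)
  also have "\<dots> = (a * r ^ 2) * (20 * norm (w - v) * r ^ 2)" by (simp flip: power_add)
  also have "\<dots> \<le> 1 / 10 * (20 * norm (w - v) * r ^ 2)"
    using small(1)[OF r] by (intro mult_right_mono) auto
  finally show ?thesis by simp
qed

lemma G_diff:
  assumes r: "r \<in> {0..S}"
  shows "norm (G w r - G v r) \<le> (201 / 10) * norm (w - v) * r ^ 4"
proof -
  have "G w r - G v r = A (q w r - q v r) - (p w r - p v r)"
    by (simp add: G_def linear_diff[OF lin] linear_add[OF lin])
  then have "norm (G w r - G v r) \<le> norm (A (q w r - q v r)) + norm (p w r - p v r)"
    by (simp add: norm_triangle_ineq4)
  also have "norm (A (q w r - q v r)) \<le> a * (norm (w - v) * r ^ 6)"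
    using a(2)[of "q w r - q v r"] q_diff[of r w v] a(1) r
    by (meson atLeastAtMost_iff mult_left_mono order_trans less_imp_le)
  also have "\<dots> = (a * r ^ 2) * (norm (w - v) * r ^ 4)" by (simp flip: power_add)
  also have "\<dots> \<le> 1 / 10 * (norm (w - v) * r ^ 4)"
    using small(1)[OF r] by (intro mult_right_mono) auto
  finally show ?thesis using p_diff[of r w v] r by simp
qed

lemma F_zero: "r \<in> {0..S} \<Longrightarrow> norm (F 0 r) \<le> a * c * r ^ 2"
  using order_trans[OF a(2)[of "X0 r"] mult_left_mono[OF X0[of r], of a]] a(1)
  by (simp add: F_def mult.assoc)

lemma G_zero: "norm (G 0 r) \<le> a * r ^ 4" if r: "r \<in> {0..S}"
proof -
  have "norm (\<Psi>0 r) \<le> r ^ 4" unfolding \<Psi>0[OF r] using r zero_le_power[of r 4] by simp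
  then have "a * norm (\<Psi>0 r) \<le> a * r ^ 4" using a(1) by (intro mult_left_mono) auto
  then show ?thesis using a(2)[of "\<Psi>0 r"] by (simp add: G_def)
qed

lemma F_bound: "norm w \<le> R \<Longrightarrow> r \<in> {0..S} \<Longrightarrow> norm (F w r) \<le> (134 * R + a * c) * r ^ 2"
  using F_diff[of w 0 r] F_zero[of r] R_pos norm_triangle_sub[of "F w r" "F 0 r"]
    mult_right_mono[of "134 * norm w" "134 * R" "r ^ 2"]
  by (simp add: algebra_simps)

lemma continuous_p: "continuous_on {0..S} (p w)" if w: "norm w \<le> R"
proof (rule continuous_on_Icc_if_power_bound[where n = 4])
  show "continuous_on {0<..S} (p w)"
    unfolding p_def by (intro continuous_intros continuous_on_compose2[OF continuous_on_apply_bcontfun[of UNIV w]]) auto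
qed (auto intro: p_bound[OF w])

lemma continuous_q: "continuous_on {0..S} (q w)" if w: "norm w \<le> R"
proof (rule continuous_on_Icc_if_power_bound[where n = 6])
  show "continuous_on {0<..S} (q w)"
    unfolding q_def by (intro continuous_intros continuous_on_compose2[OF continuous_on_apply_bcontfun[of UNIV w]]) auto
qed (auto intro: q_bound[OF w])

lemma continuous_F: "continuous_on {0..S} (F w)" if w: "norm w \<le> R"
proof -
  have sub: "continuous_on {0<..S} f" if "continuous_on {0..S} f" for f :: "real \<Rightarrow> 'a"
    using that by (rule continuous_on_subset) auto
  have "continuous_on {0..S} (\<lambda>r. sgn (\<Psi>0 r + q w r) - sgn (\<Psi>0 r))"
  proof (rule continuous_on_Icc_if_power_bound)
    have "\<Psi>0 r + q w r \<noteq> 0" "\<Psi>0 r \<noteq> 0" if r: "r \<in> {0<..S}" for r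
    proof -
      have "r ^ 4 / 132 > 0" "norm (\<Psi>0 r) > 0" using r \<Psi>0[of r] by auto
      then show "\<Psi>0 r + q w r \<noteq> 0" "\<Psi>0 r \<noteq> 0" using costate_lower[OF w, of r] r by auto
    qed
    then show "continuous_on {0<..S} (\<lambda>r. sgn (\<Psi>0 r + q w r) - sgn (\<Psi>0 r))"
      unfolding sgn_div_norm
      by (intro continuous_intros sub[OF cont0(2)] sub[OF continuous_q[OF w]]) auto
  next
    show "norm (sgn (\<Psi>0 r + q w r) - sgn (\<Psi>0 r)) \<le> 132 * norm w * r ^ 2" if "r \<in> {0..S}" for r
      using sgn_diff[OF w _ that, of 0] R_pos by simp
  qed simp
  then show ?thesis
    unfolding F_def
    by (intro continuous_on_add linear_continuous_on_compose[OF _ lin] cont0 continuous_p[OF w])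
qed

lemma continuous_G: "continuous_on {0..S} (G w)" if w: "norm w \<le> R"
  unfolding G_def
  by (intro continuous_intros linear_continuous_on_compose[OF _ lin] cont0 continuous_p[OF w] continuous_q[OF w])

lemma norm_divideR_le: "norm (u /\<^sub>R x) \<le> k" if "norm u \<le> k * x" "x > 0"
  for u :: "'b::real_normed_vector"
  using that by (simp add: field_simps)

text \<open>The components contract by 134 / (12 * 20) and (201 / 10) / 30 = 67 / 100. The norm of a
  pair is Euclidean, and the squares of these numbers sum to about 0.761 < 0.81.\<close>

lemma \<Phi>_diff:
  assumes w: "norm w \<le> R" and v: "norm v \<le> R"
  shows "norm (\<Phi> w \<tau> - \<Phi> v \<tau>) \<le> 9 / 10 * norm (w - v)"
proof -
  define s where "s = min S (exp \<tau>)"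
  have s: "s > 0" "s \<in> {0..S}" using S by (auto simp: s_def)
  have sub: "continuous_on {0..s} f" if "continuous_on {0..S} f" for f :: "real \<Rightarrow> 'a"
    using that by (rule continuous_on_subset) (use s in auto)
  note cF = continuous_F[THEN sub] and cG = continuous_G[THEN sub]
  define d where "d = norm (w - v)"
  have "norm (double_integral (F w) s - double_integral (F v) s) \<le> 134 * d * s ^ (2 + 2) / (real (2 + 1) * real (2 + 2))"
    unfolding double_integral_diff[OF cF[OF w] cF[OF v], symmetric] d_def
    using s by (intro norm_double_integral_le continuous_on_diff cF w v F_diff) auto
  then have 1: "norm ((double_integral (F w) s - double_integral (F v) s) /\<^sub>R (20 * s ^ 4)) \<le> 134 / 240 * d"
    using s by (intro norm_divideR_le) auto
  have "norm (double_integral (G w) s - double_integral (G v) s) \<le> (201 / 10) * d * s ^ (4 + 2) / (real (4 + 1) * real (4 + 2))"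
    unfolding double_integral_diff[OF cG[OF w] cG[OF v], symmetric] d_def
    using s by (intro norm_double_integral_le continuous_on_diff cG w v G_diff) auto
  then have 2: "norm ((double_integral (G w) s - double_integral (G v) s) /\<^sub>R s ^ 6) \<le> 67 / 100 * d"
    using s by (intro norm_divideR_le) auto
  have "norm (\<Phi> w \<tau> - \<Phi> v \<tau>) = sqrt ((norm ((double_integral (F w) s - double_integral (F v) s) /\<^sub>R (20 * s ^ 4)))\<^sup>2 +
      (norm ((double_integral (G w) s - double_integral (G v) s) /\<^sub>R s ^ 6))\<^sup>2)"
    unfolding \<Phi>_def s_def[symmetric] Let_def
    by (simp only: norm_Pair diff_Pair scaleR_diff_right)
  also have "\<dots> \<le> sqrt ((134 / 240 * d)\<^sup>2 + (67 / 100 * d)\<^sup>2)"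
    using 1 2 by (intro real_sqrt_le_mono add_mono power_mono) auto
  also have "\<dots> \<le> sqrt ((9 / 10 * d)\<^sup>2)"
    by (intro real_sqrt_le_mono) (simp add: power_mult_distrib power2_eq_square)
  also have "\<dots> = 9 / 10 * d" by (simp add: d_def)
  finally show ?thesis by (simp add: d_def)
qed

text \<open>With contraction factor 9 / 10, the bound \<open>R / 10\<close> is what keeps the ball
  of radius \<open>R\<close> invariant; hence the factor 10 in the choice of
  \<open>R\<close>.\<close>

lemma \<Phi>_zero: "norm (\<Phi> 0 \<tau>) \<le> R / 10"
proof -
  define s where "s = min S (exp \<tau>)"
  have s: "s > 0" "s \<in> {0..S}" using S by (auto simp: s_def)
  have sub: "continuous_on {0..s} f" if "continuous_on {0..S} f" for f :: "real \<Rightarrow> 'a"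
    using that by (rule continuous_on_subset) (use s in auto)
  have n0: "norm (0 :: real \<Rightarrow>\<^sub>C ('a \<times> 'a)) \<le> R" using R_pos by simp
  have "norm (double_integral (F 0) s) \<le> a * c * s ^ (2 + 2) / (real (2 + 1) * real (2 + 2))"
    using s by (intro norm_double_integral_le sub continuous_F n0 F_zero) auto
  then have "norm (double_integral (F 0) s /\<^sub>R (20 * s ^ 4)) \<le> a * c / 240"
    using s by (intro norm_divideR_le) auto
  moreover have "norm (double_integral (G 0) s) \<le> a * s ^ (4 + 2) / (real (4 + 1) * real (4 + 2))"
    using s by (intro norm_double_integral_le sub continuous_G n0 G_zero) auto
  then have "norm (double_integral (G 0) s /\<^sub>R s ^ 6) \<le> a / 30"
    using s by (intro norm_divideR_le) auto
  moreover have "norm (\<Phi> 0 \<tau>) \<le> norm (double_integral (F 0) s /\<^sub>R (20 * s ^ 4)) + norm (double_integral (G 0) s /\<^sub>R s ^ 6)"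
    unfolding \<Phi>_def s_def[symmetric] Let_def by (rule norm_Pair_le)
  moreover have "a * c \<ge> 0" using a c by simp
  ultimately show ?thesis using a by (simp add: R)
qed

lemma \<Phi>_bound: "norm (\<Phi> w \<tau>) \<le> R" if "norm w \<le> R"
  using \<Phi>_diff[OF that, of 0 \<tau>] \<Phi>_zero[of \<tau>] R_pos that norm_triangle_sub[of "\<Phi> w \<tau>" "\<Phi> 0 \<tau>"]
  by simp

lemma \<Phi>_bcontfun: "\<Phi> w \<in> bcontfun" if w: "norm w \<le> R"
proof (rule bcontfun_normI)
  have c: "continuous_on UNIV (\<lambda>\<tau>. h (min S (exp \<tau>)))" if "continuous_on {0..S} h" for h :: "real \<Rightarrow> 'a"
    using S by (intro continuous_on_compose2[OF that] continuous_intros) auto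
  have "min S (exp \<tau>) \<noteq> 0" for \<tau> using S by (simp add: min_def)
  then show "continuous_on UNIV (\<Phi> w)"
    unfolding \<Phi>_def Let_def
    using S by (intro continuous_intros c continuous_on_double_integral continuous_F continuous_G w) auto
qed (rule \<Phi>_bound[OF w])

lemma fixed_point:
  obtains w where "norm w \<le> R" "\<And>\<tau>. apply_bcontfun w \<tau> = \<Phi> w \<tau>"
proof -
  \<comment> \<open>Inside the ball the costate stays away from zero, so \<open>\<Phi> w\<close> is
    bounded and continuous there; only then is \<open>Bcontfun\<close> known to be
    invertible.\<close>
  have app: "apply_bcontfun (Bcontfun (\<Phi> w)) = \<Phi> w" if "norm w \<le> R" for w
    using \<Phi>_bcontfun[OF that] by (rule Bcontfun_inverse)
  have "\<exists>!w\<in>cball 0 R. Bcontfun (\<Phi> w) = w"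
  proof (rule Banach_fix)
    show "complete (cball 0 R :: (real \<Rightarrow>\<^sub>C ('a \<times> 'a)) set)"
      by (simp add: complete_eq_closed)
    show "cball 0 R \<noteq> {}" using R_pos by simp
    show "(\<lambda>w. Bcontfun (\<Phi> w)) ` cball 0 R \<subseteq> cball 0 R"
      by (auto intro!: norm_bound simp: app \<Phi>_bound)
    show "dist (Bcontfun (\<Phi> w)) (Bcontfun (\<Phi> v)) \<le> 9 / 10 * dist w v"
      if "w \<in> cball 0 R" "v \<in> cball 0 R" for w v
    proof (rule dist_bound)
      fix \<tau>
      show "dist (Bcontfun (\<Phi> w) \<tau>) (Bcontfun (\<Phi> v) \<tau>) \<le> 9 / 10 * dist w v"
        using \<Phi>_diff[of w v \<tau>] that by (simp add: app dist_norm)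
    qed
  qed auto
  then obtain w where "norm w \<le> R" "Bcontfun (\<Phi> w) = w" by auto
  then show ?thesis using app that by metis
qed

text \<open>Undoes the rescaling: for \<open>0 < s \<le> S\<close> the minimum in
  \<open>\<Phi>\<close> is inactive at \<open>\<tau> = ln s\<close>, and at \<open>s = 0\<close>
  both sides vanish.\<close>

lemma fixed_point_p_q:
  assumes w: "norm w \<le> R" "\<And>\<tau>. apply_bcontfun w \<tau> = \<Phi> w \<tau>" and s: "s \<in> {0..S}"
  shows "p w s = double_integral (F w) s" "q w s = double_integral (G w) s"
proof -
  have "p w s = double_integral (F w) s \<and> q w s = double_integral (G w) s"
  proof (cases "s = 0")
    case True
    then show ?thesis by (simp add: p_def q_def double_integral_def)
  next
    case False
    then have "s > 0" "min S (exp (ln s)) = s" using s by auto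
    then have "apply_bcontfun w (ln s) = (double_integral (F w) s /\<^sub>R (20 * s ^ 4), double_integral (G w) s /\<^sub>R s ^ 6)"
      using w(2)[of "ln s"] by (simp only: \<Phi>_def Let_def)
    then show ?thesis using \<open>s > 0\<close> by (simp add: p_def q_def)
  qed
  then show "p w s = double_integral (F w) s" "q w s = double_integral (G w) s" by auto
qed

end

text \<open>The fixed point in differential form. The error orders 4, 3 and 2 exceed by two those of
  the leading position, velocity and direction; this relative gain later becomes the remainder of
  the spiral form.\<close>

lemma perturbed_spiral_solution:
  fixes A :: "'a::euclidean_space \<Rightarrow> 'a" and X0 V0 \<Psi>0 W0 :: "real \<Rightarrow> 'a"
  assumes lin: "linear A" and c: "c \<ge> 0"
    and cont0: "continuous_on {0..1} X0" "continuous_on {0..1} V0"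
      "continuous_on {0..1} \<Psi>0" "continuous_on {0..1} W0"
    and X0: "\<And>s. s \<ge> 0 \<Longrightarrow> norm (X0 s) \<le> c * s ^ 2"
    and \<Psi>0: "\<And>s. s \<ge> 0 \<Longrightarrow> norm (\<Psi>0 s) = s ^ 4 / 126"
    and der0: "\<And>s. s > 0 \<Longrightarrow> (X0 has_vector_derivative V0 s) (at s)"
      "\<And>s. s > 0 \<Longrightarrow> (V0 has_vector_derivative sgn (\<Psi>0 s)) (at s)"
      "\<And>s. s > 0 \<Longrightarrow> (\<Psi>0 has_vector_derivative W0 s) (at s)"
      "\<And>s. s > 0 \<Longrightarrow> (W0 has_vector_derivative - X0 s) (at s)"
  obtains S M and X V \<Psi> W :: "real \<Rightarrow> 'a"
  where "S > 0" "M \<ge> 0"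
    "continuous_on {0..S} X" "continuous_on {0..S} V" "continuous_on {0..S} \<Psi>" "continuous_on {0..S} W"
    "\<And>s. s \<in> {0..S} \<Longrightarrow> norm (X s - X0 s) \<le> M * s ^ 4"
    "\<And>s. s \<in> {0..S} \<Longrightarrow> norm (V s - V0 s) \<le> M * s ^ 3"
    "\<And>s. s \<in> {0..S} \<Longrightarrow> norm (sgn (\<Psi> s) - sgn (\<Psi>0 s)) \<le> M * s ^ 2"
    "\<And>s. s \<in> {0<..S} \<Longrightarrow> \<Psi> s \<noteq> 0" "\<Psi> 0 = 0" "W 0 = W0 0"
    "\<And>s. s \<in> {0<..<S} \<Longrightarrow> (X has_vector_derivative V s) (at s)"
    "\<And>s. s \<in> {0<..<S} \<Longrightarrow> (V has_vector_derivative A (X s) + sgn (\<Psi> s)) (at s)"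
    "\<And>s. s \<in> {0<..<S} \<Longrightarrow> (\<Psi> has_vector_derivative W s) (at s)"
    "\<And>s. s \<in> {0<..<S} \<Longrightarrow> (W has_vector_derivative A (\<Psi> s) - X s) (at s)"
proof -
  obtain a where a: "a > 0" "\<And>z. norm (A z) \<le> norm z * a"
    using bounded_linear.pos_bounded[of A] lin linear_conv_bounded_linear by blast
  define R where "R = 10 * (a * c + a)"
  have Rpos: "R > 0" using a c by (simp add: R_def add_nonneg_pos)
  \<comment> \<open>A reciprocal of a sum of nonnegative terms: every smallness condition of the
    locale bounds one summand times \<open>S\<close>.\<close>
  define S where "S = 1 / (1 + 10 * a + 2772 * R)"
  have "1 + 10 * a + 2772 * R > 0" using a Rpos by linarith
  then have S: "S > 0" "S \<le> 1" "10 * a * S \<le> 1" "2772 * R * S \<le> 1"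
    using a Rpos by (auto simp: S_def field_simps)
  have sub: "continuous_on {0..S} f" if "continuous_on {0..1} f" for f :: "real \<Rightarrow> 'a"
    using that by (rule continuous_on_subset) (use S in auto)
  note cont0S = cont0[THEN sub]
  interpret perturbed_spiral A X0 \<Psi>0 a c R S
    by (rule perturbed_spiral.intro) (use lin a c cont0 X0 \<Psi>0 R_def S in \<open>auto simp: mult.commute intro: sub\<close>)
  obtain w where w: "norm w \<le> R" "\<And>\<tau>. apply_bcontfun w \<tau> = \<Phi> w \<tau>"
    using fixed_point by blast
  note pq = fixed_point_p_q[OF w]
  note contF = continuous_F[OF w(1)] and contG = continuous_G[OF w(1)]
  define P where "P s = integral {0..s} (F w)" for s
  define Q where "Q s = integral {0..s} (G w)" for s
  have int: "at s within {0..S} = at s" if "s \<in> {0<..<S}" for s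
    using that at_within_Icc_at[of 0 s S] by simp
  have derp: "(p w has_vector_derivative P s) (at s)" "(q w has_vector_derivative Q s) (at s)"
    if s: "s \<in> {0<..<S}" for s
  proof -
    have s': "s \<in> {0..S}" using s by auto
    have "(p w has_vector_derivative P s) (at s within {0..S})"
      by (rule has_vector_derivative_transform[OF s' _ double_integral_has_vector_derivative[OF contF s', folded P_def]])
        (simp add: pq)
    moreover have "(q w has_vector_derivative Q s) (at s within {0..S})"
      by (rule has_vector_derivative_transform[OF s' _ double_integral_has_vector_derivative[OF contG s', folded Q_def]])
        (simp add: pq)
    ultimately show "(p w has_vector_derivative P s) (at s)" "(q w has_vector_derivative Q s) (at s)"
      by (simp_all add: int[OF s])
  qed
  have derP: "(P has_vector_derivative F w s) (at s)" "(Q has_vector_derivative G w s) (at s)"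
    if s: "s \<in> {0<..<S}" for s
    using integral_has_vector_derivative[OF contF, of s] integral_has_vector_derivative[OF contG, of s] s
    unfolding P_def Q_def by (simp_all add: int[OF s])
  define X where "X s = X0 s + p w s" for s
  define V where "V s = V0 s + P s" for s
  define \<Psi> where "\<Psi> s = \<Psi>0 s + q w s" for s
  define W where "W s = W0 s + Q s" for s
  \<comment> \<open>The constant of \<open>F_bound\<close>, large enough to dominate the position
    error \<open>20 * R\<close> and the direction error \<open>132 * R\<close> as well.\<close>
  define M where "M = 134 * R + a * c"
  have M: "M \<ge> 20 * R" "M \<ge> 132 * R" "M \<ge> 0" using Rpos a c by (auto simp: M_def)
  show ?thesis
  proof (rule that[of S M X V \<Psi> W])
    show "S > 0" "M \<ge> 0" by fact+
    show "continuous_on {0..S} X" "continuous_on {0..S} \<Psi>"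
      unfolding X_def \<Psi>_def by (intro continuous_intros cont0S continuous_p continuous_q w)+
    show "continuous_on {0..S} V" "continuous_on {0..S} W"
      unfolding V_def W_def P_def Q_def
      by (intro continuous_intros cont0S indefinite_integral_continuous_1
          integrable_continuous_real contF contG)+
    show "norm (X s - X0 s) \<le> M * s ^ 4" if "s \<in> {0..S}" for s
      using p_bound[OF w(1), of s] mult_right_mono[OF M(1), of "s ^ 4"] that by (simp add: X_def)
    show "norm (V s - V0 s) \<le> M * s ^ 3" if s: "s \<in> {0..S}" for s
    proof -
      have "norm (P s) \<le> M * s ^ (2 + 1) / real (2 + 1)"
        unfolding P_def M_def
        by (intro norm_integral_power_le continuous_on_subset[OF contF] F_bound w(1)) (use s in auto)
      also have "\<dots> \<le> M * s ^ 3"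
        using M(3) s by (simp add: eval_nat_numeral divide_le_eq mult_nonneg_nonneg)
      finally show ?thesis by (simp add: V_def)
    qed
    show "norm (sgn (\<Psi> s) - sgn (\<Psi>0 s)) \<le> M * s ^ 2" if s: "s \<in> {0..S}" for s
    proof -
      have "norm (sgn (\<Psi> s) - sgn (\<Psi>0 s)) \<le> 132 * norm w * s ^ 2"
        using sgn_diff[OF w(1) _ s, of 0] Rpos by (simp add: \<Psi>_def)
      also have "\<dots> \<le> M * s ^ 2" using M(2) w(1) by (intro mult_right_mono) auto
      finally show ?thesis .
    qed
    show "\<Psi> s \<noteq> 0" if s: "s \<in> {0<..S}" for s
    proof -
      have "s ^ 4 / 132 > 0" "s \<in> {0..S}" using s by auto
      then show ?thesis using costate_lower[OF w(1), of s] by (auto simp: \<Psi>_def)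
    qed
    show "\<Psi> 0 = 0" using \<Psi>0[of 0] less_imp_le[OF S(1)] by (simp add: \<Psi>_def q_def)
    show "W 0 = W0 0" by (simp add: W_def Q_def)
    fix s assume s: "s \<in> {0<..<S}"
    then have "s > 0" by auto
    show "(X has_vector_derivative V s) (at s)" "(\<Psi> has_vector_derivative W s) (at s)"
      unfolding X_def V_def \<Psi>_def W_def
      by (intro has_vector_derivative_add der0 derp \<open>s > 0\<close> s)+
    have "(V has_vector_derivative (sgn (\<Psi>0 s) + F w s)) (at s)"
      unfolding V_def by (intro has_vector_derivative_add der0 derP \<open>s > 0\<close> s)
    then show "(V has_vector_derivative A (X s) + sgn (\<Psi> s)) (at s)"
      by (simp add: F_def X_def \<Psi>_def)
    have "(W has_vector_derivative (- X0 s + G w s)) (at s)"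
      unfolding W_def by (intro has_vector_derivative_add der0 derP \<open>s > 0\<close> s)
    then show "(W has_vector_derivative A (\<Psi> s) - X s) (at s)"
      by (simp add: G_def X_def \<Psi>_def algebra_simps)
  qed
qed

section \<open>Spirals and their rotations\<close>

text \<open>The quotient of the images of \<open>\<i>\<close> and 1 is a unit vector orthogonal to
  1, hence \<open>\<i>\<close> or \<open>- \<i>\<close>; the two signs are rotation and
  reflection.\<close>

lemma orthogonal_transformation_complex_cases:
  fixes \<zeta> :: "complex \<Rightarrow> complex"
  assumes "orthogonal_transformation \<zeta>"
  obtains w where "norm w = 1" "\<And>z. \<zeta> z = w * z"
  | w where "norm w = 1" "\<And>z. \<zeta> z = w * cnj z"
proof -
  have lin: "linear \<zeta>" and norm: "norm (\<zeta> z) = norm z" and inn: "\<zeta> z \<bullet> \<zeta> z' = z \<bullet> z'" for z z'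
    using assms orthogonal_transformation by (auto simp: orthogonal_transformation_def)
  define w where "w = \<zeta> 1"
  define v where "v = \<zeta> \<i> / w"
  have w: "norm w = 1" "w \<noteq> 0" using norm[of 1] by (auto simp: w_def)
  have "norm v = 1" using w norm[of \<i>] by (simp add: v_def norm_divide)
  have "Re v = 0"
  proof -
    have "Re (\<zeta> \<i> * cnj w) = w \<bullet> \<zeta> \<i>" by (simp add: inner_complex_def mult.commute)
    also have "\<dots> = 0" using inn[of 1 \<i>] by (simp add: w_def inner_complex_def)
    finally have "Re (\<zeta> \<i> * cnj w) = 0" .
    moreover have "v = \<zeta> \<i> * cnj w"
      using w by (simp add: v_def divide_conv_cnj)
    ultimately show ?thesis by simp
  qed
  then have "\<bar>Im v\<bar> = 1" using \<open>norm v = 1\<close> by (simp add: cmod_def)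
  then have v: "v = \<i> \<or> v = - \<i>"
    using \<open>Re v = 0\<close> by (auto simp: complex_eq_iff abs_if split: if_splits)
  have "\<zeta> z = w * (of_real (Re z) + of_real (Im z) * v)" for z
  proof -
    have "z = Re z *\<^sub>R 1 + Im z *\<^sub>R \<i>" by (simp add: complex_eq_iff)
    then have "\<zeta> z = Re z *\<^sub>R \<zeta> 1 + Im z *\<^sub>R \<zeta> \<i>"
      by (metis lin linear_add linear_scale)
    moreover have "\<zeta> \<i> = w * v" using w by (simp add: v_def)
    ultimately show ?thesis by (simp add: w_def scaleR_conv_of_real algebra_simps)
  qed
  with v show ?thesis
  proof (elim disjE)
    assume "v = \<i>" "\<And>z. \<zeta> z = w * (of_real (Re z) + of_real (Im z) * v)"
    then have "\<zeta> z = w * z" for z by (simp add: complex_eq_iff)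
    then show ?thesis using w that(1) by blast
  next
    assume "v = - \<i>" "\<And>z. \<zeta> z = w * (of_real (Re z) + of_real (Im z) * v)"
    then have "\<zeta> z = w * cnj z" for z by (simp add: complex_eq_iff)
    then show ?thesis using w that(2) by blast
  qed
qed

text \<open>Conjugation reverses the sign of the exponent. Only its absolute value is tracked, since
  unbounded winding does not depend on the sense of rotation.\<close>

lemma orthogonal_spiral:
  fixes \<zeta> :: "complex \<Rightarrow> complex"
  assumes "orthogonal_transformation \<zeta>"
  obtains \<kappa> \<beta> where "norm \<kappa> = norm k" "\<bar>\<beta>\<bar> = \<bar>\<alpha>\<bar>"
    "\<And>r \<phi>. \<zeta> (k * of_real r * exp (\<i> * of_real (\<alpha> * \<phi>))) = \<kappa> * of_real r * cis (\<beta> * \<phi>)"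
  using assms
proof (cases rule: orthogonal_transformation_complex_cases)
  case (1 w)
  show ?thesis
    by (rule that[of "w * k" \<alpha>]) (simp_all add: 1 norm_mult cis_conv_exp)
next
  case (2 w)
  show ?thesis
    by (rule that[of "w * cnj k" "- \<alpha>"]) (simp_all add: 2 norm_mult cis_conv_exp exp_cnj)
qed

lemma rcis_norm_Ln: "z \<noteq> 0 \<Longrightarrow> z = of_real (norm z) * cis (Im (Ln z))"
  by (metis exp_Ln exp_eq_polar norm_exp_eq_Re)

text \<open>Dividing by the leading spiral turns the error bound into
  \<open>norm (g (T - t)) \<le> M * (T - t) ^ 2\<close>, which is o(T - t) and stays below 1 by the
  choice of \<open>T\<close>. Hence \<open>1 + g\<close> remains in the right half-plane and cannot
  undo the winding.\<close>

lemma perturbed_spiral_form: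
  fixes \<zeta> :: "complex \<Rightarrow> complex"
  assumes orth: "orthogonal_transformation \<zeta>" and k: "k \<noteq> 0" and \<alpha>: "\<alpha> \<noteq> 0"
    and T: "T > 0" and M: "M * T ^ 2 < 1" "M \<ge> 0"
    and cont: "continuous_on {0..<T} f"
    and close: "\<And>t. t \<in> {0..<T} \<Longrightarrow>
      norm (f t - \<zeta> (k * of_real ((T - t) ^ n) * exp (\<i> * of_real (\<alpha> * ln (T - t)))))
        \<le> M * norm k * (T - t) ^ (n + 2)"
  shows "spiral_form \<zeta> k n \<alpha> 1 T f" "infinitely_many_rotations T f"
proof -
  obtain \<kappa> \<beta> where \<kappa>: "norm \<kappa> = norm k" and \<beta>: "\<bar>\<beta>\<bar> = \<bar>\<alpha>\<bar>"
    and lead: "\<And>r \<phi>. \<zeta> (k * of_real r * exp (\<i> * of_real (\<alpha> * \<phi>))) = \<kappa> * of_real r * cis (\<beta> * \<phi>)"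
    using orthogonal_spiral[OF orth] by metis
  have "\<kappa> \<noteq> 0" using \<kappa> k by auto
  define l where "l t = \<kappa> * of_real ((T - t) ^ n) * cis (\<beta> * ln (T - t))" for t
  have l: "norm (l t) = norm k * (T - t) ^ n" "l t \<noteq> 0" if "t \<in> {0..<T}" for t
    using that \<open>\<kappa> \<noteq> 0\<close> \<kappa> by (auto simp: l_def norm_mult norm_power simp del: of_real_diff)
  define g where "g s = f (T - s) / l (T - s) - 1" for s
  have f: "f t = l t * (1 + g (T - t))" if "t \<in> {0..<T}" for t
    using l(2)[OF that] by (simp add: g_def)
  have g: "norm (g (T - t)) \<le> M * (T - t) ^ 2" if t: "t \<in> {0..<T}" for t
  proof -
    have "norm (g (T - t)) = norm (f t - l t) / norm (l t)"
      using l(2)[OF t] by (simp add: g_def divide_simps flip: norm_divide)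
    also have "\<dots> \<le> (M * norm k * (T - t) ^ (n + 2)) / (norm k * (T - t) ^ n)"
      unfolding l(1)[OF t] using close[OF t, unfolded lead, folded l_def] t
      by (intro divide_right_mono) auto
    also have "\<dots> = M * (T - t) ^ 2" using k t by (simp add: power_add power2_eq_square)
    finally show ?thesis .
  qed
  have g1: "norm (g (T - t)) < 1" if t: "t \<in> {0..<T}" for t
  proof -
    have "M * (T - t) ^ 2 \<le> M * T ^ 2" using t M(2) by (intro mult_left_mono power_mono) auto
    then show ?thesis using g[OF t] M(1) by simp
  qed
  show "spiral_form \<zeta> k n \<alpha> 1 T f"
    unfolding spiral_form_def
  proof (intro exI[of _ g] conjI allI impI)
    fix t assume "0 \<le> t \<and> t < T"
    then show "f t = \<zeta> (k * of_real ((T - t) ^ n) * exp (\<i> * of_real (\<alpha> * ln \<bar>T - t\<bar>))) * (1 + g (T - t))"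
      using f[of t] by (simp only: lead l_def abs_of_pos) auto
  next
    show "(\<lambda>t. g (T - t)) \<in> o[at_left T](\<lambda>t. of_real ((T - t) powr 1))"
    proof (rule landau_o.smallI)
      fix c :: real assume "c > 0"
      \<comment> \<open>Chosen so that \<open>M * (T - t) < c\<close> for \<open>t > b\<close>; the
        \<open>+ 1\<close> covers \<open>M = 0\<close>, and the maximum keeps \<open>t\<close> in
        the range where \<open>g\<close> is controlled.\<close>
      define b where "b = max 0 (T - c / (M + 1))"
      have "b < T" using \<open>c > 0\<close> M T by (simp add: b_def)
      moreover have "norm (g (T - t)) \<le> c * norm (complex_of_real ((T - t) powr 1))"
        if t: "t > b" "t < T" for t
      proof -
        have "T - t < c / (M + 1)" using t by (simp add: b_def)
        then have "(M + 1) * (T - t) < c" using M by (simp add: field_simps)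
        then have "M * (T - t) < c" using t by (simp add: algebra_simps)
        then have "M * (T - t) * (T - t) \<le> c * (T - t)" using t by (intro mult_right_mono) auto
        then have "M * (T - t) ^ 2 \<le> c * (T - t)" by (simp add: power2_eq_square)
        then show ?thesis using g[of t] t by (simp add: b_def del: of_real_diff)
      qed
      ultimately show "\<forall>\<^sub>F t in at_left T. norm (g (T - t)) \<le> c * norm (complex_of_real ((T - t) powr 1))"
        using eventually_at_left[of b T] by blast
    qed
  qed
  \<comment> \<open>Only the logarithm is unbounded. The last term is continuous because
    \<open>1 + g\<close> avoids the branch cut of \<open>Ln\<close>.\<close>
  define \<theta> where "\<theta> t = Im (Ln \<kappa>) + \<beta> * ln (T - t) + Im (Ln (1 + g (T - t)))" for t
  have Re: "Re (1 + g (T - t)) > 0" if "t \<in> {0..<T}" for t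
    using g1[OF that] abs_Re_le_cmod[of "g (T - t)"] by simp
  show "infinitely_many_rotations T f"
    unfolding infinitely_many_rotations_def
  proof (intro exI[of _ \<theta>] conjI ballI)
    have "continuous_on {0..<T} (\<lambda>t. f t / l t)"
      using l(2) unfolding l_def by (intro continuous_intros cont) auto
    then have "continuous_on {0..<T} (\<lambda>t. 1 + g (T - t))" by (simp add: g_def)
    then have contLn: "continuous_on {0..<T} (\<lambda>t. Ln (1 + g (T - t)))"
    proof (rule continuous_on_Ln')
      show "1 + g (T - t) \<notin> \<real>\<^sub>\<le>\<^sub>0" if "t \<in> {0..<T}" for t
        using Re[OF that] by (simp add: complex_nonpos_Reals_iff)
    qed
    show "continuous_on {0..<T} \<theta>"
      unfolding \<theta>_def
      by (rule continuous_on_add[OF _ continuous_on_Im[OF contLn]]) (auto intro!: continuous_intros)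
  next
    fix t assume t: "t \<in> {0..<T}"
    have n0: "1 + g (T - t) \<noteq> 0" using Re[OF t] by force
    then show "f t \<noteq> 0" using f[OF t] l[OF t] by simp
    have "f t = (of_real (norm \<kappa>) * cis (Im (Ln \<kappa>))) * of_real ((T - t) ^ n) * cis (\<beta> * ln (T - t)) *
        (of_real (norm (1 + g (T - t))) * cis (Im (Ln (1 + g (T - t)))))"
      using rcis_norm_Ln[OF \<open>\<kappa> \<noteq> 0\<close>] rcis_norm_Ln[OF n0] by (simp add: f[OF t] l_def)
    also have "\<dots> = of_real (norm \<kappa> * (T - t) ^ n * norm (1 + g (T - t))) * cis (\<theta> t)"
      by (simp add: \<theta>_def cis_mult[symmetric])
    finally have eq: "f t = of_real (norm \<kappa> * (T - t) ^ n * norm (1 + g (T - t))) * cis (\<theta> t)" .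
    moreover have "norm (f t) = norm \<kappa> * (T - t) ^ n * norm (1 + g (T - t))"
      using t by (simp add: f l_def norm_mult norm_power del: of_real_diff)
    ultimately show "f t = rcis (norm (f t)) (\<theta> t)" by (simp add: rcis_def)
  next
    have "filterlim (\<lambda>t. T - t) (at_right 0) (at_left T)"
      by (auto simp: filterlim_at eventually_at_filter intro!: tendsto_eq_intros)
    then have "filterlim (\<lambda>t. ln (T - t)) at_bot (at_left T)"
      by (rule filterlim_compose[OF ln_at_0])
    then have "filterlim (\<lambda>t. - ln (T - t)) at_top (at_left T)"
      by (rule filterlim_compose[OF filterlim_uminus_at_top_at_bot])
    then have "filterlim (\<lambda>t. (- 2 * pi) + \<bar>\<beta>\<bar> * - ln (T - t)) at_top (at_left T)"
      using \<beta> \<alpha> by (intro filterlim_tendsto_add_at_top[OF tendsto_const] filterlim_tendsto_pos_mult_at_top[OF tendsto_const]) auto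
    then show "filterlim (\<lambda>t. \<bar>\<theta> t\<bar>) at_top (at_left T)"
    proof (rule filterlim_at_top_mono)
      \<comment> \<open>The two principal arguments in \<open>\<theta>\<close> are at most
        \<open>pi\<close> each in absolute value.\<close>
      have "(- 2 * pi) + \<bar>\<beta>\<bar> * - ln (T - t) \<le> \<bar>\<theta> t\<bar>" if "t > 0" "t < T" for t
      proof -
        have "1 + g (T - t) \<noteq> 0" using Re[of t] that by force
        then have "\<bar>Im (Ln (1 + g (T - t)))\<bar> \<le> pi"
          by (simp add: abs_le_iff Im_Ln_le_pi mpi_less_Im_Ln less_imp_le minus_le_iff)
        moreover have "\<bar>Im (Ln \<kappa>)\<bar> \<le> pi"
          using \<open>\<kappa> \<noteq> 0\<close> by (simp add: abs_le_iff Im_Ln_le_pi mpi_less_Im_Ln less_imp_le minus_le_iff)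
        moreover have "\<bar>\<beta>\<bar> * - ln (T - t) \<le> \<bar>\<beta> * ln (T - t)\<bar>"
          unfolding abs_mult by (intro mult_left_mono) auto
        ultimately show ?thesis unfolding \<theta>_def by linarith
      qed
      then show "\<forall>\<^sub>F t in at_left T. (- 2 * pi) + \<bar>\<beta>\<bar> * - ln (T - t) \<le> \<bar>\<theta> t\<bar>"
        unfolding eventually_at_left[OF T] using T by blast
    qed
  qed
qed

section \<open>Optimal spirals\<close>

lemma bounded_on_Icc_if_continuous:
  fixes f :: "real \<Rightarrow> 'a::real_normed_vector"
  assumes "continuous_on {a..b} f"
  obtains B where "B \<ge> 0" "\<And>t. t \<in> {a..b} \<Longrightarrow> norm (f t) \<le> B"
proof -
  have "bounded (f ` {a..b})"
    using assms by (intro compact_imp_bounded compact_continuous_image) auto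
  then show ?thesis
    unfolding bounded_pos using that by (metis imageI less_imp_le)
qed

text \<open>After time \<open>T\<close> the trajectory rests at the value at \<open>s = 0\<close>, which is the origin.\<close>

definition reverse :: "real \<Rightarrow> (real \<Rightarrow> 'a) \<Rightarrow> real \<Rightarrow> 'a" where
  "reverse T f t = f (max 0 (T - t))"

lemma continuous_on_reverse:
  assumes "continuous_on {0..T} f" "T \<ge> 0"
  shows "continuous_on {0..} (reverse T f)"
  unfolding reverse_def
  by (rule continuous_on_compose2[OF assms(1)]) (use assms(2) in \<open>auto intro!: continuous_intros\<close>)

lemma reverse_has_vector_derivative:
  fixes f :: "real \<Rightarrow> 'a::real_normed_vector"
  assumes "(f has_vector_derivative f') (at (T - t))" "t < T"
  shows "(reverse T f has_vector_derivative - f') (at t)"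
proof -
  have "((\<lambda>t. T - t) has_vector_derivative - 1) (at t)"
    by (auto intro!: derivative_eq_intros)
  from vector_diff_chain_at[OF this assms(1)]
  have "((\<lambda>t. f (T - t)) has_vector_derivative - f') (at t)" by (simp add: o_def)
  then show ?thesis
    by (rule has_vector_derivative_transform_within_open[of _ _ _ "{..<T}"])
      (use assms(2) in \<open>auto simp: reverse_def\<close>)
qed

lemma reverse_has_vector_derivative_after:
  fixes f :: "real \<Rightarrow> 'a::real_normed_vector"
  assumes "t > T"
  shows "(reverse T f has_vector_derivative 0) (at t)"
  by (rule has_vector_derivative_transform_within_open[of "\<lambda>_. f 0" _ _ "{T<..}"])
    (use assms in \<open>auto simp: reverse_def\<close>)

text \<open>Reversing and stopping at \<open>T\<close> is composition with a 1-Lipschitz map, so one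
  estimate covers the times before and after \<open>T\<close>.\<close>

lemma abs_cont_on_reverse:
  fixes f f' :: "real \<Rightarrow> 'a::real_inner"
  assumes cont: "continuous_on {0..T} f" and T: "T \<ge> 0" and L: "L \<ge> 0"
    and der: "\<And>s. s \<in> {0<..<T} \<Longrightarrow> (f has_vector_derivative f' s) (at s)"
    and le: "\<And>s. s \<in> {0<..<T} \<Longrightarrow> norm (f' s) \<le> L"
  shows "abs_cont_on {0..b} (reverse T f)"
proof (rule lipschitz_imp_abs_cont_on)
  have 1: "1-lipschitz_on {0..b} (\<lambda>t. max 0 (T - t))"
    by (auto simp: lipschitz_on_def dist_real_def max_def)
  have "L-lipschitz_on {0..T} f"
    using cont L der le by (rule bounded_vector_derivative_imp_lipschitz_on)
  then have "L-lipschitz_on ((\<lambda>t. max 0 (T - t)) ` {0..b}) f"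
    by (rule lipschitz_on_subset) (use T in auto)
  from lipschitz_on_compose2[OF 1 this] show "(L * 1)-lipschitz_on {0..b} (reverse T f)"
    by (simp add: reverse_def[abs_def])
qed

section \<open>Exact logarithmic spirals in the plane\<close>

definition vec2 :: "complex \<Rightarrow> real^2" where
  "vec2 z = vector [Re z, Im z]"

lemma cplx_vec2 [simp]: "cplx (vec2 z) = z"
  by (simp add: cplx_def vec2_def)

lemma norm_cplx [simp]: "norm (cplx v) = norm v"
  by (simp add: cplx_def cmod_def norm_vec_def L2_set_def sum_2)

lemma linear_cplx: "linear cplx"
  by (rule linearI) (auto simp: cplx_def complex_eq_iff)

lemma linear_vec2: "linear vec2"
  by (rule linearI) (auto simp: vec2_def vec_eq_iff forall_2)

lemma norm_vec2 [simp]: "norm (vec2 z) = norm z"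
  by (metis cplx_vec2 norm_cplx)

text \<open>The complex power of \<open>s\<close> with exponent n + i alpha; differentiation lowers
  \<open>n\<close> and multiplies by the exponent. Since \<open>ln 0 = 0\<close>, the value at 0 is
  0 for \<open>n > 0\<close> and 1 for \<open>n = 0\<close>.\<close>

definition spiral :: "real \<Rightarrow> nat \<Rightarrow> real \<Rightarrow> complex" where
  "spiral \<alpha> n s = of_real (s ^ n) * exp (\<i> * of_real (\<alpha> * ln s))"

lemma norm_spiral: "s \<ge> 0 \<Longrightarrow> norm (spiral \<alpha> n s) = s ^ n"
  by (simp add: spiral_def norm_mult norm_power)

lemma spiral_has_vector_derivative:
  assumes "s > 0"
  shows "(spiral \<alpha> (Suc n) has_vector_derivative (of_nat (Suc n) + \<i> * \<alpha>) * spiral \<alpha> n s) (at s)"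
proof -
  have "((\<lambda>s. \<i> * of_real (\<alpha> * ln s)) has_vector_derivative \<i> * of_real (\<alpha> * (1 / s))) (at s)"
    using assms
    by (intro has_vector_derivative_mult_right has_vector_derivative_of_real)
      (auto intro!: derivative_eq_intros simp: has_real_derivative_iff_has_vector_derivative[symmetric])
  from field_vector_diff_chain_at[OF this DERIV_exp]
  have 1: "((\<lambda>s. exp (\<i> * of_real (\<alpha> * ln s))) has_vector_derivative
      \<i> * of_real (\<alpha> * (1 / s)) * exp (\<i> * of_real (\<alpha> * ln s))) (at s)" by (simp add: o_def)
  have 2: "((\<lambda>s. complex_of_real (s ^ Suc n)) has_vector_derivative of_real (real (Suc n) * s ^ n)) (at s)"
    using DERIV_pow[of "Suc n" s UNIV]
    by (intro has_vector_derivative_of_real)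
      (simp add: has_real_derivative_iff_has_vector_derivative[symmetric])
  have "complex_of_real (s ^ Suc n) * (\<i> * of_real (\<alpha> * (1 / s)) * exp (\<i> * of_real (\<alpha> * ln s))) +
      of_real (real (Suc n) * s ^ n) * exp (\<i> * of_real (\<alpha> * ln s)) = (of_nat (Suc n) + \<i> * \<alpha>) * spiral \<alpha> n s"
    using assms by (simp add: spiral_def field_simps)
  with has_vector_derivative_mult[OF 2 1] show ?thesis
    unfolding spiral_def[abs_def] by simp
qed

lemma continuous_on_spiral: "continuous_on {0..b} (spiral \<alpha> n)" if n: "n > 0"
proof (rule continuous_on_Icc_if_power_bound[OF _ n])
  show "continuous_on {0<..b} (spiral \<alpha> n)"
    unfolding spiral_def by (intro continuous_intros) auto
  show "norm (spiral \<alpha> n r) \<le> 1 * r ^ n" if "r \<in> {0..b}" for r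
    using that by (simp add: norm_spiral)
qed

text \<open>The root \<open>\<alpha>\<^sup>2 = 5\<close> makes this product a negative real, which is what
  \<open>x'' = \<psi> / \<parallel>\<psi>\<parallel>\<close>, \<open>\<psi>'' = - x\<close> requires of a spiral \<open>\<psi>\<close> of order \<open>4\<close> when \<open>K = 0\<close>.\<close>

lemma characteristic_product:
  assumes "\<alpha>\<^sup>2 = 5"
  shows "(1 + \<i> * complex_of_real \<alpha>) * (2 + \<i> * \<alpha>) * ((3 + \<i> * \<alpha>) * (4 + \<i> * \<alpha>)) = - 126"
proof -
  define z where "z = \<i> * complex_of_real \<alpha>"
  have z: "z * z = - 5"
    using arg_cong[OF assms, of complex_of_real] by (simp add: z_def power_mult_distrib flip: power2_eq_square)
  have z3: "z * (z * w) = - 5 * w" for w using z by (metis mult.assoc)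
  show ?thesis unfolding z_def[symmetric] by (simp add: algebra_simps z z3)
qed

text \<open>The constants are normalised by the control, whose leading coefficient is 1: integrating
  twice gives \<open>k\<^sub>x\<close>, and \<open>k\<^sub>y\<close> is the derivative with the
  minus sign of reversed time.\<close>

lemma orthogonal_spiral_optimal:
  fixes K :: "real^2^2" and \<alpha> :: real and \<zeta> :: "complex \<Rightarrow> complex"
  defines "k\<^sub>x \<equiv> 1 / ((1 + \<i> * \<alpha>) * (2 + \<i> * \<alpha>))"
  defines "k\<^sub>y \<equiv> - (2 + \<i> * \<alpha>) * k\<^sub>x"
  assumes sym: "\<And>v w. (K *v v) \<bullet> w = v \<bullet> (K *v w)"
    and \<alpha>: "\<alpha>\<^sup>2 = 5" and orth: "orthogonal_transformation \<zeta>"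
  shows "\<exists>x0 y0 x y u T. optimal K x0 y0 x y u \<and> 0 < T \<and>
      spiral_form \<zeta> k\<^sub>x 2 \<alpha> 1 T (\<lambda>t. cplx (x t)) \<and>
      spiral_form \<zeta> k\<^sub>y 1 \<alpha> 1 T (\<lambda>t. cplx (y t)) \<and>
      spiral_form \<zeta> 1 0 \<alpha> 1 T (\<lambda>t. cplx (u t)) \<and>
      (x T, y T) = (0, 0) \<and> (\<forall>t\<in>{0..<T}. (x t, y t) \<noteq> (0, 0)) \<and>
      infinitely_many_rotations T (\<lambda>t. cplx (x t)) \<and>
      infinitely_many_rotations T (\<lambda>t. cplx (y t)) \<and>
      infinitely_many_rotations T (\<lambda>t. cplx (u t))"
proof -
  have lin\<zeta>: "linear \<zeta>" and norm\<zeta>: "norm (\<zeta> z) = norm z" for z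
    using orth by (auto simp: orthogonal_transformation)
  have nz: "n + \<i> * \<alpha> \<noteq> 0" if "n > 0" for n :: real
    using that by (simp add: complex_eq_iff)
  have nz12: "1 + \<i> * \<alpha> \<noteq> 0" "2 + \<i> * \<alpha> \<noteq> 0" using nz[of 1] nz[of 2] by simp_all
  then have kx: "k\<^sub>x \<noteq> 0" and ky: "k\<^sub>y \<noteq> 0" by (simp_all add: k\<^sub>x_def k\<^sub>y_def)
  have "\<alpha> \<noteq> 0" using \<alpha> by auto
  define E where "E z = vec2 (\<zeta> z)" for z
  have linE: "linear E"
    using linear_compose[OF lin\<zeta> linear_vec2] by (simp add: E_def[abs_def] o_def)
  have blE: "bounded_linear E" using linE linear_conv_bounded_linear by blast
  have normE [simp]: "norm (E z) = norm z" and cplxE [simp]: "cplx (E z) = \<zeta> z" for z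
    by (simp_all add: E_def norm\<zeta>)
  define X0 where "X0 s = E (k\<^sub>x * spiral \<alpha> 2 s)" for s
  define V0 where "V0 s = E (k\<^sub>x * (2 + \<i> * \<alpha>) * spiral \<alpha> 1 s)" for s
  define \<Psi>0 where "\<Psi>0 s = E (1 / 126 * spiral \<alpha> 4 s)" for s
  define W0 where "W0 s = E ((4 + \<i> * \<alpha>) / 126 * spiral \<alpha> 3 s)" for s
  have contE: "continuous_on {0..b} (\<lambda>s. E (k * spiral \<alpha> n s))" if "n > 0" for b k n
    by (intro linear_continuous_on_compose[OF _ linE] continuous_intros continuous_on_spiral that)
  have derE: "((\<lambda>s. E (k * spiral \<alpha> (Suc n) s)) has_vector_derivative
      E (k * ((of_nat (Suc n) + \<i> * \<alpha>) * spiral \<alpha> n s))) (at s)" if "s > 0" for s k n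
    by (intro bounded_linear.has_vector_derivative[OF blE] has_vector_derivative_mult_right
        spiral_has_vector_derivative that)
  have norm\<Psi>0: "norm (\<Psi>0 s) = s ^ 4 / 126" if "s \<ge> 0" for s
    using that by (simp add: \<Psi>0_def norm_mult norm_spiral norm_divide)
  have sgn\<Psi>0: "sgn (\<Psi>0 s) = E (spiral \<alpha> 0 s)" if "s > 0" for s
  proof -
    have "sgn (\<Psi>0 s) = E ((126 / s ^ 4) *\<^sub>R (1 / 126 * spiral \<alpha> 4 s))"
      using that norm\<Psi>0[of s] by (simp only: sgn_div_norm linear_scale[OF linE]) (simp add: \<Psi>0_def)
    also have "(126 / s ^ 4) *\<^sub>R (1 / 126 * spiral \<alpha> 4 s) = spiral \<alpha> 0 s"
      using that by (simp add: spiral_def scaleR_conv_of_real)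
    finally show ?thesis .
  qed
  \<comment> \<open>Consistency of the two equations: differentiating the costate spiral twice must
    return \<open>- k\<^sub>x\<close>, the very coefficient obtained by integrating the control
    twice.\<close>
  have kx': "(4 + \<i> * \<alpha>) / 126 * (3 + \<i> * \<alpha>) = - k\<^sub>x"
  proof -
    have "b / 126 = - (1 / a)" if "a * b = - 126" "a \<noteq> 0" for a b :: complex
      using that by (simp add: field_simps)
    from this[OF characteristic_product[OF \<alpha>]] show ?thesis
      using nz12 by (simp add: k\<^sub>x_def mult.commute)
  qed
  obtain S M X V \<Psi> W where S: "S > 0" and M: "M \<ge> 0"
    and contS: "continuous_on {0..S} X" "continuous_on {0..S} V" "continuous_on {0..S} \<Psi>" "continuous_on {0..S} W"
    and X: "\<And>s. s \<in> {0..S} \<Longrightarrow> norm (X s - X0 s) \<le> M * s ^ 4"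
    and V: "\<And>s. s \<in> {0..S} \<Longrightarrow> norm (V s - V0 s) \<le> M * s ^ 3"
    and U: "\<And>s. s \<in> {0..S} \<Longrightarrow> norm (sgn (\<Psi> s) - sgn (\<Psi>0 s)) \<le> M * s ^ 2"
    and \<Psi>: "\<And>s. s \<in> {0<..S} \<Longrightarrow> \<Psi> s \<noteq> 0" "\<Psi> 0 = 0" and W: "W 0 = W0 0"
    and derS: "\<And>s. s \<in> {0<..<S} \<Longrightarrow> (X has_vector_derivative V s) (at s)"
      "\<And>s. s \<in> {0<..<S} \<Longrightarrow> (V has_vector_derivative K *v X s + sgn (\<Psi> s)) (at s)"
      "\<And>s. s \<in> {0<..<S} \<Longrightarrow> (\<Psi> has_vector_derivative W s) (at s)"
      "\<And>s. s \<in> {0<..<S} \<Longrightarrow> (W has_vector_derivative K *v \<Psi> s - X s) (at s)"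
  proof (rule perturbed_spiral_solution[of "(*v) K" "norm k\<^sub>x" X0 V0 \<Psi>0 W0])
    show "continuous_on {0..1} X0" "continuous_on {0..1} V0" "continuous_on {0..1} \<Psi>0" "continuous_on {0..1} W0"
      unfolding X0_def V0_def \<Psi>0_def W0_def by (intro contE; simp)+
    show "norm (X0 s) \<le> norm k\<^sub>x * s ^ 2" if "s \<ge> 0" for s
      using that by (simp add: X0_def norm_mult norm_spiral)
    fix s :: real assume s: "s > 0"
    show "(X0 has_vector_derivative V0 s) (at s)"
      unfolding X0_def V0_def using derE[OF s, of k\<^sub>x 1] by (simp add: numeral_2_eq_2 mult.assoc)
    have "k\<^sub>x * (2 + \<i> * \<alpha>) * ((of_nat (Suc 0) + \<i> * \<alpha>) * z) = z" for z
      using nz12 by (simp add: k\<^sub>x_def)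
    then show "(V0 has_vector_derivative sgn (\<Psi>0 s)) (at s)"
      unfolding V0_def sgn\<Psi>0[OF s] One_nat_def
      using derE[OF s, of "k\<^sub>x * (2 + \<i> * \<alpha>)" 0] by (simp only:)
    show "(\<Psi>0 has_vector_derivative W0 s) (at s)"
      unfolding \<Psi>0_def W0_def using derE[OF s, of "1 / 126" 3] by (simp add: mult.assoc)
    have "((\<lambda>s. E ((4 + \<i> * \<alpha>) / 126 * spiral \<alpha> (Suc 2) s)) has_vector_derivative
        E ((4 + \<i> * \<alpha>) / 126 * (3 + \<i> * \<alpha>) * spiral \<alpha> 2 s)) (at s)"
      using derE[OF s, of "(4 + \<i> * \<alpha>) / 126" 2] by (simp add: mult.assoc)
    then show "(W0 has_vector_derivative - X0 s) (at s)"
      unfolding W0_def X0_def kx' linear_neg[OF linE, symmetric] by (simp add: numeral_3_eq_3 numeral_2_eq_2)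
  qed (use norm\<Psi>0 in auto)
  \<comment> \<open>The errors are measured relative to the leading coefficients, and
    \<open>N\<close> bounds all three constants. With \<open>T \<le> 1 / (1 + N)\<close>, also
    \<open>T ^ 2 \<le> T\<close>, so that \<open>N * T ^ 2 < 1\<close>.\<close>
  define N where "N = M / norm k\<^sub>x + M / norm k\<^sub>y + M"
  have N: "N \<ge> 0" using M by (simp add: N_def)
  define T where "T = min S (1 / (1 + N))"
  have T: "T > 0" "T \<le> S" "T \<le> 1 / (1 + N)" using S N by (auto simp: T_def)
  have small: "m * T ^ 2 < 1" if "m \<le> N" "m \<ge> 0" for m
  proof -
    have "T \<le> 1" using T(3) N by (simp add: order_trans)
    then have "T ^ 2 \<le> T" using T(1) by (simp add: power2_eq_square mult_left_le)
    then have "m * T ^ 2 \<le> N * T" using that T(1) by (intro mult_mono) auto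
    also have "\<dots> \<le> N * (1 / (1 + N))" using T N by (intro mult_left_mono)
    also have "\<dots> < 1" using N by simp
    finally show ?thesis .
  qed
  have zero: "spiral \<alpha> n 0 = 0" if "n > 0" for n using that by (simp add: spiral_def)
  have at0: "X 0 = 0" "V 0 = 0" "W 0 = 0"
    using X[of 0] V[of 0] W S by (simp_all add: X0_def V0_def W0_def zero linear_0[OF linE])
  note cont = contS[THEN continuous_on_subset, of "{0..T}"]
  define x where "x = reverse T X"
  define y where "y = reverse T (\<lambda>s. - V s)"
  define u where "u = reverse T (\<lambda>s. sgn (\<Psi> s))"
  define \<psi> where "\<psi> = reverse T \<Psi>"
  define \<psi>' where "\<psi>' = reverse T (\<lambda>s. - W s)"
  have u_sgn: "u t = sgn (\<psi> t)" for t by (simp add: u_def \<psi>_def reverse_def)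
  have contX: "continuous_on {0..T} X" "continuous_on {0..T} V" "continuous_on {0..T} \<Psi>" "continuous_on {0..T} W"
    using cont T(2) by auto
  have derT: "(X has_vector_derivative V s) (at s)"
      "((\<lambda>s. - V s) has_vector_derivative - (K *v X s + sgn (\<Psi> s))) (at s)"
      "(\<Psi> has_vector_derivative W s) (at s)"
      "((\<lambda>s. - W s) has_vector_derivative - (K *v \<Psi> s - X s)) (at s)" if "s \<in> {0<..<T}" for s
  proof -
    have s: "s \<in> {0<..<S}" using that T(2) by auto
    show "(X has_vector_derivative V s) (at s)"
      "((\<lambda>s. - V s) has_vector_derivative - (K *v X s + sgn (\<Psi> s))) (at s)"
      "(\<Psi> has_vector_derivative W s) (at s)"
      "((\<lambda>s. - W s) has_vector_derivative - (K *v \<Psi> s - X s)) (at s)"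
      by (rule derS[OF s] has_vector_derivative_minus[OF derS(2)[OF s]]
          has_vector_derivative_minus[OF derS(4)[OF s]])+
  qed
  have contK: "continuous_on {0..T} (\<lambda>s. K *v X s)" "continuous_on {0..T} (\<lambda>s. K *v \<Psi> s - X s)"
    by (rule linear_continuous_on_compose[OF contX(1) matrix_vector_mul_linear]
        continuous_on_diff[OF linear_continuous_on_compose[OF contX(3) matrix_vector_mul_linear] contX(1)])+
  obtain BV where BV: "BV \<ge> 0" "\<And>s. s \<in> {0..T} \<Longrightarrow> norm (V s) \<le> BV"
    using bounded_on_Icc_if_continuous[OF contX(2)] by metis
  obtain BW where BW: "BW \<ge> 0" "\<And>s. s \<in> {0..T} \<Longrightarrow> norm (W s) \<le> BW"
    using bounded_on_Icc_if_continuous[OF contX(4)] by metis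
  obtain BK where BK: "BK \<ge> 0" "\<And>s. s \<in> {0..T} \<Longrightarrow> norm (K *v X s) \<le> BK"
    using bounded_on_Icc_if_continuous[OF contK(1)] by metis
  obtain BL where BL: "BL \<ge> 0" "\<And>s. s \<in> {0..T} \<Longrightarrow> norm (K *v \<Psi> s - X s) \<le> BL"
    using bounded_on_Icc_if_continuous[OF contK(2)] by metis
  have sgn1: "norm (sgn v) \<le> 1" for v :: "real^2" by (simp add: norm_sgn)
  have acx: "abs_cont_on {0..b} x" and ac\<psi>: "abs_cont_on {0..b} \<psi>"
    and acy: "abs_cont_on {0..b} y" and ac\<psi>': "abs_cont_on {0..b} \<psi>'" for b
  proof -
    show "abs_cont_on {0..b} x" unfolding x_def
      by (rule abs_cont_on_reverse[OF contX(1) _ BV(1) derT(1)]) (use BV(2) T in auto)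
    show "abs_cont_on {0..b} \<psi>" unfolding \<psi>_def
      by (rule abs_cont_on_reverse[OF contX(3) _ BW(1) derT(3)]) (use BW(2) T in auto)
    show "abs_cont_on {0..b} y" unfolding y_def
    proof (rule abs_cont_on_reverse[OF continuous_on_minus[OF contX(2)] _ _ derT(2)])
      show "norm (- (K *v X s + sgn (\<Psi> s))) \<le> BK + 1" if "s \<in> {0<..<T}" for s
        using norm_triangle_ineq[of "K *v X s" "sgn (\<Psi> s)"] BK(2)[of s] sgn1[of "\<Psi> s"] that
        unfolding norm_minus_cancel by auto
    qed (use T BK in auto)
    show "abs_cont_on {0..b} \<psi>'" unfolding \<psi>'_def
      by (rule abs_cont_on_reverse[OF continuous_on_minus[OF contX(4)] _ BL(1) derT(4)])
        (use BL(2) T in \<open>auto simp: norm_minus_commute\<close>)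
  qed
  have derx: "(x has_vector_derivative y t) (at t)"
    and dery: "(y has_vector_derivative K *v x t + u t) (at t)"
    and der\<psi>: "(\<psi> has_vector_derivative \<psi>' t) (at t)"
    and der\<psi>': "(\<psi>' has_vector_derivative K *v \<psi> t - x t) (at t)" if t: "t > 0" "t \<noteq> T" for t
  proof -
    have "(x has_vector_derivative y t) (at t) \<and> (y has_vector_derivative K *v x t + u t) (at t) \<and>
      (\<psi> has_vector_derivative \<psi>' t) (at t) \<and> (\<psi>' has_vector_derivative K *v \<psi> t - x t) (at t)"
    proof (cases "t < T")
      case True
      then have s: "T - t \<in> {0<..<T}" using t by auto
      show ?thesis
        using derT[OF s, THEN reverse_has_vector_derivative[OF _ True]] True
        unfolding x_def y_def u_def \<psi>_def \<psi>'_def by (simp add: reverse_def add.commute)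
    next
      case False
      \<comment> \<open>After \<open>T\<close> state and costate rest at zero, which solves all four
        equations because \<open>sgn 0 = 0\<close> switches the control off.\<close>
      then have "t > T" using t by simp
      then show ?thesis
        unfolding x_def y_def u_def \<psi>_def \<psi>'_def
        by (simp add: reverse_def[of T _ t] at0 \<Psi>(2) reverse_has_vector_derivative_after)
    qed
    then show "(x has_vector_derivative y t) (at t)" "(y has_vector_derivative K *v x t + u t) (at t)"
      "(\<psi> has_vector_derivative \<psi>' t) (at t)" "(\<psi>' has_vector_derivative K *v \<psi> t - x t) (at t)"
      by auto
  qed
  have ae: "AE t in lebesgue_on {0..}. Q t" if Q: "\<And>t. t > 0 \<Longrightarrow> t \<noteq> T \<Longrightarrow> Q t" for Q
  proof -
    have "{0, T} \<in> null_sets lebesgue" by (simp flip: negligible_iff_null_sets)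
    then have "AE t in lebesgue. t \<in> {0..} \<longrightarrow> Q t"
      by (rule AE_I') (use Q in \<open>auto simp: le_less\<close>)
    then show ?thesis by (subst AE_restrict_space_iff) auto
  qed
  have "admissible K (x 0) (y 0) x y u"
    unfolding admissible_def
  proof (intro conjI allI impI acx acy ae derx dery refl)
    have "continuous_on {0..} \<psi>"
      unfolding \<psi>_def using T by (intro continuous_on_reverse contX) auto
    then have "\<psi> \<in> borel_measurable (lebesgue_on {0..})"
      by (rule continuous_imp_measurable_on_sets_lebesgue) auto
    then show "u \<in> borel_measurable (lebesgue_on {0..})"
      unfolding u_sgn[abs_def] sgn_div_norm by measurable
    show "norm (u t) \<le> 1" for t by (simp add: u_sgn sgn1)
  qed
  then have "optimal K (x 0) (y 0) x y u"
  proof (rule optimal_if_costate[OF sym])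
    show "0 \<le> T" using T by simp
    show "\<psi> T = 0" "\<psi>' T = 0" by (simp_all add: \<psi>_def \<psi>'_def reverse_def \<Psi> at0)
    show "x t = 0" if "t \<ge> T" for t using that by (simp add: x_def reverse_def at0)
  qed (use ac\<psi> ac\<psi>' der\<psi> der\<psi>' u_sgn in auto)
  moreover have sub: "{0..<T} \<subseteq> {0..}" by auto
  have contx: "continuous_on {0..<T} x" and conty: "continuous_on {0..<T} y" and cont\<psi>: "continuous_on {0..<T} \<psi>"
    unfolding x_def y_def \<psi>_def using T
    by (intro continuous_on_subset[OF continuous_on_reverse sub] contX continuous_on_minus; simp)+
  have lead: "cplx (E (k * spiral \<alpha> n (T - t))) =
      \<zeta> (k * of_real ((T - t) ^ n) * exp (\<i> * of_real (\<alpha> * ln (T - t))))" for k n t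
    by (simp add: spiral_def mult.assoc)
  have formx: "norm (cplx (x t) - cplx (E (k\<^sub>x * spiral \<alpha> 2 (T - t)))) \<le>
      M / norm k\<^sub>x * norm k\<^sub>x * (T - t) ^ (2 + 2)" if t: "t \<in> {0..<T}" for t
    using X[of "T - t"] t T kx
    by (simp add: x_def reverse_def X0_def del: cplxE flip: linear_diff[OF linear_cplx])
  have formy: "norm (cplx (y t) - cplx (E (k\<^sub>y * spiral \<alpha> 1 (T - t)))) \<le>
      M / norm k\<^sub>y * norm k\<^sub>y * (T - t) ^ (1 + 2)" if t: "t \<in> {0..<T}" for t
  proof -
    have "E (k\<^sub>y * spiral \<alpha> 1 (T - t)) = - V0 (T - t)"
      unfolding V0_def linear_neg[OF linE, symmetric] by (simp add: k\<^sub>y_def algebra_simps)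
    then have "cplx (y t) - cplx (E (k\<^sub>y * spiral \<alpha> 1 (T - t))) = cplx (- (V (T - t) - V0 (T - t)))"
      using t by (simp add: y_def reverse_def del: cplxE flip: linear_diff[OF linear_cplx])
    then show ?thesis
      using V[of "T - t"] t T ky by (simp add: norm_minus_commute power3_eq_cube mult.assoc)
  qed
  have formu: "norm (cplx (u t) - cplx (E (1 * spiral \<alpha> 0 (T - t)))) \<le>
      M * norm (1::complex) * (T - t) ^ (0 + 2)" if t: "t \<in> {0..<T}" for t
  proof -
    have "cplx (u t) - cplx (E (1 * spiral \<alpha> 0 (T - t))) = cplx (sgn (\<Psi> (T - t)) - sgn (\<Psi>0 (T - t)))"
      using t sgn\<Psi>0[of "T - t"] by (simp add: u_def reverse_def linear_diff[OF linear_cplx])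
    then show ?thesis using U[of "T - t"] t T by (simp add: power2_eq_square)
  qed
  have \<psi>0: "\<psi> t \<noteq> 0" if "t \<in> {0..<T}" for t
    using \<Psi>(1)[of "T - t"] that T by (simp add: \<psi>_def reverse_def)
  have MN: "M / norm k\<^sub>x \<le> N" "M / norm k\<^sub>y \<le> N" "M \<le> N" using M by (simp_all add: N_def)
  have Mk: "M / norm k\<^sub>x \<ge> 0" "M / norm k\<^sub>y \<ge> 0" using M by simp_all
  have contu: "continuous_on {0..<T} u"
    unfolding u_sgn[abs_def] sgn_div_norm using \<psi>0 by (intro continuous_intros cont\<psi>) auto
  note contc = linear_continuous_on_compose[OF _ linear_cplx]
  note spiralx = perturbed_spiral_form[OF orth kx \<open>\<alpha> \<noteq> 0\<close> T(1) small[OF MN(1) Mk(1)] Mk(1)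
      contc[OF contx] formx[unfolded lead]]
  note spiraly = perturbed_spiral_form[OF orth ky \<open>\<alpha> \<noteq> 0\<close> T(1) small[OF MN(2) Mk(2)] Mk(2)
      contc[OF conty] formy[unfolded lead]]
  note spiralu = perturbed_spiral_form[OF orth one_neq_zero \<open>\<alpha> \<noteq> 0\<close> T(1) small[OF MN(3) M] M
      contc[OF contu] formu[unfolded lead]]
  moreover have "(x T, y T) = (0, 0)" by (simp add: x_def y_def reverse_def at0)
  \<comment> \<open>A curve with a continuous argument has no zero, so the origin is not reached
    before \<open>T\<close>.\<close>
  moreover have "(x t, y t) \<noteq> (0, 0)" if "t \<in> {0..<T}" for t
  proof -
    have "cplx (x t) \<noteq> 0"
      using spiralx(2) that unfolding infinitely_many_rotations_def by blast
    then show ?thesis by (auto simp: linear_0[OF linear_cplx])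
  qed
  ultimately show ?thesis using T(1) spiralx spiraly spiralu by blast
qed

theorem theorem1:
  fixes K :: "real^2^2" and \<alpha> :: real
  assumes diagonal: "\<And>i j. i \<noteq> j \<Longrightarrow> K $ i $ j = 0"
    and nondegenerate: "invertible K"
    and alpha: "\<alpha> = sqrt 5 \<or> \<alpha> = - sqrt 5"
  shows "\<exists>k\<^sub>x k\<^sub>y k\<^sub>u :: complex. \<exists>\<sigma>>0. k\<^sub>x \<noteq> 0 \<and> k\<^sub>y \<noteq> 0 \<and> k\<^sub>u \<noteq> 0 \<and>
    (\<forall>\<zeta> :: complex \<Rightarrow> complex. orthogonal_transformation \<zeta> \<longrightarrow>
      (\<exists>x0 y0 x y u T. optimal K x0 y0 x y u \<and> 0 < T \<and>
        spiral_form \<zeta> k\<^sub>x 2 \<alpha> \<sigma> T (\<lambda>t. cplx (x t)) \<and>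
        spiral_form \<zeta> k\<^sub>y 1 \<alpha> \<sigma> T (\<lambda>t. cplx (y t)) \<and>
        spiral_form \<zeta> k\<^sub>u 0 \<alpha> \<sigma> T (\<lambda>t. cplx (u t)) \<and>
        (x T, y T) = (0, 0) \<and> (\<forall>t\<in>{0..<T}. (x t, y t) \<noteq> (0, 0)) \<and>
        infinitely_many_rotations T (\<lambda>t. cplx (x t)) \<and>
        infinitely_many_rotations T (\<lambda>t. cplx (y t)) \<and>
        infinitely_many_rotations T (\<lambda>t. cplx (u t))))"
proof -
  have sym: "(K *v v) \<bullet> w = v \<bullet> (K *v w)" for v w
    using diagonal[of 1 2] diagonal[of 2 1]
    by (simp add: inner_vec_def matrix_vector_mult_def sum_2)
  have "\<alpha>\<^sup>2 = 5" using alpha by auto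
  note sol = orthogonal_spiral_optimal[OF sym this]
  have "1 + \<i> * \<alpha> \<noteq> 0" "2 + \<i> * \<alpha> \<noteq> 0" by (simp_all add: complex_eq_iff)
  then show ?thesis
    \<comment> \<open>The coefficients depend on \<open>\<alpha>\<close> alone, so they can be fixed
      before \<open>\<zeta>\<close>. Both k_u and sigma are 1.\<close>
    by (intro exI[of _ "1 / ((1 + \<i> * \<alpha>) * (2 + \<i> * \<alpha>))"]
        exI[of _ "- (2 + \<i> * \<alpha>) * (1 / ((1 + \<i> * \<alpha>) * (2 + \<i> * \<alpha>)))"]
        exI[of _ 1] conjI allI impI sol) auto
qed

end
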